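(* Let $M_1,\dots,M_N$ be (distinct) parallel planes in $\mathbb{R}^3$, or (distinct) concentric spheres in $\mathbb{R}^3$, with union $M=M_1\cup\dots\cup M_N$. Let $G=(V,E)$ be a finite simple connected graph with vertex set $V=\{v_1,\dots,v_n\}$, $n\ge 2$, and let $\pi:V\to\{1,\dots,N\}$ be a map. Then $G$ admits a minimally rigid completely regular framework $(G,p)$ on $M$ with $p_k\in M_{\pi(v_k)}$ for each $k$ if and only if $G$ is a Laman graph.
   Context: For a graph $H$ write $f(H)=2|V(H)|-|E(H)|$. A Laman graph (also called a $(2,3)$-tight graph) is a finite simple graph $G$ with $f(G)=3$ and $f(H)\ge 3$ for every subgraph $H$ containing at least one edge. Frameworks. A surface $M\subset\mathbb{R}^3$ is a smooth embedded two-dimensional submanifold, not necessarily connected. For a finite simple connected graph $G=(V,E)$ with $V=\{v_1,\dots,v_n\}$, a framework $(G,p)$ on $M$ is given by $p=(p_1,\dots,p_n)\in M^n$, with $p_i$ the point assigned to $v_i$. For a subgraph $H$ of $G$ (not necessarily connected), $(H,p)$ denotes $H$ together with the restriction of $p$ to $V(H)$; $K_n$ denotes the complete graph on $V$. Rigidity. $V_M(G,p)$ is the set of $q\in M^n$ with $|q_i-q_j|^2=|p_i-p_j|^2$ for all edges $v_iv_j$ of $G$. $(G,p)$ is (continuously) rigid if for every continuous path $p:[0,1]\to V_M(G,p)$ with $p(0)=p$ there is $\delta>0$ with $p([0,\delta))\subseteq V_M(K_n,p)$. It is minimally rigid if it is rigid and, for every edge $e$ of $G$, $(G\setminus e,p)$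 is not rigid. Regularity. Near each $p_i$ let $M$ be given by $h_i=0$, where $h_i$ is a smooth function near $p_i$ with nonvanishing gradient. The augmented edge function is $\tilde f_G(q)=\big((|q_i-q_j|^2)_{v_iv_j\in E},h_1(q_1),\dots,h_n(q_n)\big)$, defined for $q\in\mathbb{R}^{3n}$ near $p$. $(G,p)$ is regular on $M$ if the rank of the derivative $D\tilde f_G$ at $p$ is maximal among its ranks at points of some neighbourhood of $p$ in $\mathbb{R}^{3n}$. $(G,p)$ is completely regular if $(H,p)$ is regular on $M$ for each subgraph $H$ of $G$. *)

theory Defs
  imports "HOL-Analysis.Analysis"
begin

text \<open>Graphs: a vertex set together with a set of two-element edges.\<close>

definition simple_graph :: "'v set \<Rightarrow> 'v set set \<Rightarrow> bool" where
  "simple_graph V E \<longleftrightarrow> finite V \<and> (\<forall>e\<in>E. e \<subseteq> V \<and> card e = 2)"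

definition subgraph :: "'v set \<Rightarrow> 'v set set \<Rightarrow> 'v set \<Rightarrow> 'v set set \<Rightarrow> bool" where
  "subgraph W F V E \<longleftrightarrow> simple_graph W F \<and> W \<subseteq> V \<and> F \<subseteq> E"

definition connected_graph :: "'v set \<Rightarrow> 'v set set \<Rightarrow> bool" where
  "connected_graph V E \<longleftrightarrow> (\<forall>u\<in>V. \<forall>w\<in>V. (u, w) \<in> {(i, j). {i, j} \<in> E}\<^sup>*)"

definition complete_edges :: "'v set \<Rightarrow> 'v set set" where
  "complete_edges V = {e. e \<subseteq> V \<and> card e = 2}"

definition freedom :: "'v set \<Rightarrow> 'v set set \<Rightarrow> int" where
  "freedom V E = 2 * int (card V) - int (card E)"

definition laman_graph :: "'v set \<Rightarrow> 'v set set \<Rightarrow> bool" where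
  "laman_graph V E \<longleftrightarrow> simple_graph V E \<and> freedom V E = 3 \<and>
     (\<forall>W F. subgraph W F V E \<and> F \<noteq> {} \<longrightarrow> freedom W F \<ge> 3)"


definition parallel_planes :: "nat \<Rightarrow> (nat \<Rightarrow> (real^3) set) \<Rightarrow> bool" where
  "parallel_planes N S \<longleftrightarrow> inj_on S {1..N} \<and>
     (\<exists>a. a \<noteq> 0 \<and> (\<forall>k\<in>{1..N}. \<exists>b. S k = {x. a \<bullet> x = b}))"

definition concentric_spheres :: "nat \<Rightarrow> (nat \<Rightarrow> (real^3) set) \<Rightarrow> bool" where
  "concentric_spheres N S \<longleftrightarrow> inj_on S {1..N} \<and>
     (\<exists>c. \<forall>k\<in>{1..N}. \<exists>r>0. S k = sphere c r)"

text \<open>\<open>Ck_on k S g\<close> is meant for open \<open>S\<close>: there it says that \<open>g\<close> is \<open>k\<close> times continuously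
  differentiable, expressed through iterated directional derivatives.\<close>

primrec Ck_on :: "nat \<Rightarrow> 'a::real_normed_vector set \<Rightarrow> ('a \<Rightarrow> real) \<Rightarrow> bool" where
  "Ck_on 0 S g \<longleftrightarrow> continuous_on S g"
| "Ck_on (Suc k) S g \<longleftrightarrow> (\<forall>x\<in>S. g differentiable (at x)) \<and>
     (\<forall>u. Ck_on k S (\<lambda>x. frechet_derivative g (at x) u))"

definition smooth_on :: "'a::real_normed_vector set \<Rightarrow> ('a \<Rightarrow> real) \<Rightarrow> bool" where
  "smooth_on S g \<longleftrightarrow> (\<forall>k. Ck_on k S g)"

definition local_equation :: "(real^3) set \<Rightarrow> real^3 \<Rightarrow> (real^3 \<Rightarrow> real) \<Rightarrow> bool" where
  "local_equation M x g \<longleftrightarrow> (\<exists>U. open U \<and> x \<in> U \<and> smooth_on U g \<and>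
     (\<forall>y\<in>U. \<exists>D. GDERIV g y :> D \<and> D \<noteq> 0) \<and> M \<inter> U = {y\<in>U. g y = 0})"


text \<open>The full vertex set of a framework is the finite type \<open>'v\<close>, so that placements are points of
  the Euclidean space \<open>(real^3)^'v\<close>. Well-definedness of the squared length of an edge
  is \<open>edge_sq_length_doubleton\<close>.\<close>

definition edge_sq_length :: "(real^3)^'v \<Rightarrow> 'v set \<Rightarrow> real" where
  "edge_sq_length q e = (THE d. \<exists>i j. e = {i, j} \<and> d = (norm (q $ i - q $ j))\<^sup>2)"

lemma edge_sq_length_doubleton: "edge_sq_length q {i, j} = (norm (q $ i - q $ j))\<^sup>2"
  unfolding edge_sq_length_def
  by (rule the_equality) (auto simp: doubleton_eq_iff norm_minus_commute)

text \<open>The set \<open>V\<^sub>M(G,p)\<close>.\<close>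

definition placements :: "(real^3) set \<Rightarrow> 'v set set \<Rightarrow> (real^3)^'v \<Rightarrow> ((real^3)^'v) set" where
  "placements M E p = {q. (\<forall>i. q $ i \<in> M) \<and>
     (\<forall>e\<in>E. edge_sq_length q e = edge_sq_length p e)}"

definition rigid :: "(real^3) set \<Rightarrow> 'v::finite set set \<Rightarrow> (real^3)^'v \<Rightarrow> bool" where
  "rigid M E p \<longleftrightarrow>
     (\<forall>\<gamma>. path \<gamma> \<and> path_image \<gamma> \<subseteq> placements M E p \<and> pathstart \<gamma> = p \<longrightarrow>
        (\<exists>\<delta>\<in>{0<..1}. \<gamma> ` {0..<\<delta>} \<subseteq> placements M (complete_edges UNIV) p))"

definition minimally_rigid :: "(real^3) set \<Rightarrow> 'v::finite set set \<Rightarrow> (real^3)^'v \<Rightarrow> bool" where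
  "minimally_rigid M E p \<longleftrightarrow> rigid M E p \<and> (\<forall>e\<in>E. \<not> rigid M (E - {e}) p)"

text \<open>The augmented edge function of a subgraph \<open>(W, F)\<close>. It is written on all of
  \<open>(real^3)^'v\<close>, with one coordinate for each potential edge (\<open>Inl\<close>) and each
  vertex (\<open>Inr\<close>); coordinates that do not belong to \<open>(W, F)\<close> are constantly zero. As the
  remaining coordinates only involve the positions of the vertices in \<open>W\<close>, the rank of the
  derivative, and its local maximality, are the same as for the function of the positions
  of the vertices in \<open>W\<close> alone.\<close>

definition augmented_edge_fun ::
    "'v::finite set \<Rightarrow> 'v set set \<Rightarrow> ('v \<Rightarrow> real^3 \<Rightarrow> real) \<Rightarrow> (real^3)^'v \<Rightarrow> real^('v set + 'v)" where
  "augmented_edge_fun W F h q = (\<chi> c. case c of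
       Inl e \<Rightarrow> if e \<in> F then edge_sq_length q e else 0
     | Inr i \<Rightarrow> if i \<in> W then h i (q $ i) else 0)"

definition derivative_rank ::
    "('a::euclidean_space \<Rightarrow> 'b::euclidean_space) \<Rightarrow> 'a \<Rightarrow> nat" where
  "derivative_rank g q = dim (range (frechet_derivative g (at q)))"

definition regular ::
    "('v \<Rightarrow> real^3 \<Rightarrow> real) \<Rightarrow> 'v::finite set \<Rightarrow> 'v set set \<Rightarrow> (real^3)^'v \<Rightarrow> bool" where
  "regular h W F p \<longleftrightarrow> (\<forall>\<^sub>F q in nhds p.
     derivative_rank (augmented_edge_fun W F h) q \<le> derivative_rank (augmented_edge_fun W F h) p)"

definition completely_regular ::
    "('v \<Rightarrow> real^3 \<Rightarrow> real) \<Rightarrow> 'v::finite set set \<Rightarrow> (real^3)^'v \<Rightarrow> bool" where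
  "completely_regular h E p \<longleftrightarrow> (\<forall>W F. subgraph W F UNIV E \<longrightarrow> regular h W F p)"

text \<open>Regularity refers to local equations \<open>h\<^sub>i = 0\<close> of \<open>M\<close> near the points \<open>p\<^sub>i\<close>. A choice of
  these for every framework \<open>p\<close> on \<open>M\<close> is a family \<open>h p i\<close>; no particular choice is distinguished.\<close>

definition local_equations ::
    "(real^3) set \<Rightarrow> ((real^3)^'v \<Rightarrow> 'v \<Rightarrow> real^3 \<Rightarrow> real) \<Rightarrow> bool" where
  "local_equations M h \<longleftrightarrow>
     (\<forall>p. (\<forall>i. p $ i \<in> M) \<longrightarrow> (\<forall>i. local_equation M (p $ i) (h p i)))"

end

theory Submission
  imports Defs
begin

text \<open>Planes and spheres are level sets of a common potential with affine gradient, and they have a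
  three-dimensional group of isometries. A placement of the vertices of a graph on such surfaces is
  described by the gradients of the edge lengths together with the normals that hold the vertices on
  their surfaces. The infinitesimal isometries are orthogonal to all of them, so independent
  gradients of edges on a vertex set \<open>W\<close> number at most \<open>2 |W| - 3\<close> (\<open>indep_gradients_count\<close>), which is the
  Laman count.

  If the gradients are independent and there are \<open>2 n - 3\<close> edges, the framework is rigid
  (\<open>rigid_of_indep_tight\<close>). All constraints being quadratic, the difference of two placements with equal edge
  lengths is an infinitesimal motion of their midpoint, hence an infinitesimal isometry, hence all
  distances agree. Removing an edge leaves an infinitesimal motion that changes its length, and by
  the inverse function theorem it is realised by a curve (\<open>not_rigid_remove_edge\<close>). Independence
  also makes every subgraph regular.

  Conversely, a rigid regular framework has an independent set of \<open>2 n - 3\<close> edges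
  (\<open>tight_basis_of_rigid\<close>). With fewer independent edges there would be an infinitesimal motion fixing the end
  points of one edge, regularity would integrate it to a motion preserving all edge lengths,
  and a congruence with such a velocity is trivial. By minimality these are all edges,
  and the count for subgraphs gives the Laman property. Thus everything reduces to the existence of
  a placement with independent gradients on the prescribed surfaces.

  For a Laman graph such a placement exists in a plane, by an induction that removes a vertex of degree two
  or three (\<open>plane_placement_exists\<close>). Independence in the plane depends only on the
  orthogonal projections, so the vertices may be shifted to parallel planes at will. Central projection
  carries infinitesimal motions in a plane to infinitesimal motions on concentric spheres
  of arbitrary radii and rescales the edge gradients (\<open>planar_independence_on_spheres\<close>).\<close>

section \<open>Independent families of vectors and curves in level sets\<close>

text \<open>Independence of an indexed family, so that a repeated vector counts as a dependence: two
  constraints with equal gradients are to be recognised as redundant.\<close>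

definition indep_family :: "'c set \<Rightarrow> ('c \<Rightarrow> 'a::real_vector) \<Rightarrow> bool" where
  "indep_family C r \<longleftrightarrow> (\<forall>l. (\<Sum>c\<in>C. l c *\<^sub>R r c) = 0 \<longrightarrow> (\<forall>c\<in>C. l c = 0))"

lemma indep_familyD:
  "indep_family C r \<Longrightarrow> (\<Sum>c\<in>C. l c *\<^sub>R r c) = 0 \<Longrightarrow> c \<in> C \<Longrightarrow> l c = 0"
  by (auto simp: indep_family_def)

lemma indep_family_mono:
  assumes "indep_family C r" "D \<subseteq> C" "finite C"
  shows "indep_family D r"
  unfolding indep_family_def
proof (intro allI impI ballI)
  fix l c assume l: "(\<Sum>c\<in>D. l c *\<^sub>R r c) = 0" and c: "c \<in> D"
  have "(\<Sum>c\<in>C. (if c \<in> D then l c else 0) *\<^sub>R r c) = (\<Sum>c\<in>D. l c *\<^sub>R r c)"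
    by (rule sum.mono_neutral_cong_right) (use assms in auto)
  with l have "(\<Sum>c\<in>C. (if c \<in> D then l c else 0) *\<^sub>R r c) = 0"
    by simp
  from indep_familyD[OF assms(1) this, of c] c assms(2) show "l c = 0"
    by auto
qed

lemma indep_family_not_in_span:
  assumes "indep_family C r" "finite C" "c \<in> C"
  shows "r c \<notin> span (r ` (C - {c}))"
proof
  assume "r c \<in> span (r ` (C - {c}))"
  then obtain u where u: "(\<Sum>v\<in>r ` (C - {c}). u v *\<^sub>R v) = r c"
    using span_finite[of "r ` (C - {c})"] assms(2) by auto
  obtain D where D: "D \<subseteq> C - {c}" "inj_on r D" "r ` (C - {c}) = r ` D"
    using subset_image_inj[of "r ` (C - {c})" r "C - {c}"] by auto
  define l where "l = (\<lambda>x. if x = c then - 1 else u (r x))"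
  have fD: "finite D" "c \<notin> D"
    using D(1) assms(2) finite_subset by blast+
  have "(\<Sum>x\<in>insert c D. l x *\<^sub>R r x) = - r c + (\<Sum>x\<in>D. u (r x) *\<^sub>R r x)"
    using fD by (auto simp: l_def intro!: sum.cong)
  also have "(\<Sum>x\<in>D. u (r x) *\<^sub>R r x) = r c"
    using u D(3) sum.reindex[OF D(2), of "\<lambda>v. u v *\<^sub>R v"] by simp
  finally have "(\<Sum>x\<in>insert c D. l x *\<^sub>R r x) = 0" by simp
  moreover have "indep_family (insert c D) r"
    by (rule indep_family_mono[OF assms(1) _ assms(2)]) (use D(1) assms(3) in auto)
  ultimately have "l c = 0"
    by (auto dest: indep_familyD)
  then show False by (simp add: l_def)
qed

lemma indep_family_dim:
  assumes "indep_family C r" "finite C"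
  shows "dim (r ` C) = card C"
proof -
  have inj: "inj_on r C"
  proof (rule inj_onI, rule ccontr)
    fix x y assume xy: "x \<in> C" "y \<in> C" "r x = r y" "x \<noteq> y"
    then have "r x \<in> span (r ` (C - {x}))"
      by (intro span_base) auto
    with indep_family_not_in_span[OF assms xy(1)] show False by simp
  qed
  have "independent (r ` C)"
    unfolding dependent_def
  proof safe
    fix c assume c: "c \<in> C" "r c \<in> span (r ` C - {r c})"
    have "r ` C - {r c} \<subseteq> r ` (C - {c})" by auto
    with c(2) have "r c \<in> span (r ` (C - {c}))"
      using span_mono by blast
    with indep_family_not_in_span[OF assms c(1)] show False by simp
  qed
  then show ?thesis
    using card_image[OF inj] by (simp add: dim_eq_card_independent)
qed

lemma in_span_of_not_indep_insert:
  assumes "indep_family C r" "\<not> indep_family (insert c C) r" "finite C"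
  shows "r c \<in> span (r ` C)"
proof -
  from assms(1,2) have c: "c \<notin> C"
    by (auto simp: insert_absorb)
  from assms(2) obtain l k where l: "(\<Sum>x\<in>insert c C. l x *\<^sub>R r x) = 0"
    and k: "k \<in> insert c C" "l k \<noteq> 0"
    unfolding indep_family_def by blast
  have eq: "l c *\<^sub>R r c + (\<Sum>x\<in>C. l x *\<^sub>R r x) = 0"
    using l c assms(3) by simp
  have lc: "l c \<noteq> 0"
  proof
    assume "l c = 0"
    with eq have "(\<Sum>x\<in>C. l x *\<^sub>R r x) = 0" by simp
    with indep_familyD[OF assms(1) this] k \<open>l c = 0\<close> show False by auto
  qed
  have "l c *\<^sub>R r c = - (\<Sum>x\<in>C. l x *\<^sub>R r x)"
    using eq by (simp add: eq_neg_iff_add_eq_0)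
  moreover have "(\<Sum>x\<in>C. l x *\<^sub>R r x) \<in> span (r ` C)"
    by (intro span_sum span_scale span_base) auto
  ultimately have "inverse (l c) *\<^sub>R (l c *\<^sub>R r c) \<in> span (r ` C)"
    by (simp add: span_neg span_scale)
  then show ?thesis using lc by simp
qed

lemma indep_family_dual_vector:
  fixes r :: "'c \<Rightarrow> 'a::euclidean_space"
  assumes "indep_family C r" "finite C" "c \<in> C"
  obtains w where "r c \<bullet> w = 1" "\<And>k. k \<in> C \<Longrightarrow> k \<noteq> c \<Longrightarrow> r k \<bullet> w = 0"
proof -
  obtain y z where y: "y \<in> span (r ` (C - {c}))"
    and z: "\<And>w. w \<in> span (r ` (C - {c})) \<Longrightarrow> orthogonal z w" and rc: "r c = y + z"
    using orthogonal_subspace_decomp_exists[of "r ` (C - {c})" "r c"] by metis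
  have "z \<noteq> 0"
    using indep_family_not_in_span[OF assms] y rc by auto
  have zy: "z \<bullet> y = 0"
    using z[OF y] by (simp add: orthogonal_def)
  show ?thesis
  proof
    show "r c \<bullet> ((1 / (z \<bullet> z)) *\<^sub>R z) = 1"
      using \<open>z \<noteq> 0\<close> zy by (simp add: rc inner_add_left inner_commute[of y])
    show "r k \<bullet> ((1 / (z \<bullet> z)) *\<^sub>R z) = 0" if "k \<in> C" "k \<noteq> c" for k
      using z[of "r k"] that span_base[of "r k" "r ` (C - {c})"]
      by (auto simp: orthogonal_def inner_commute)
  qed
qed

text \<open>Independence is an open condition: an injective linear map is bounded below on the unit
  sphere of the coefficient space, and this bound survives small changes of the vectors.\<close>

lemma eventually_indep_family:
  fixes r :: "'c::finite \<Rightarrow> 'b::topological_space \<Rightarrow> 'a::euclidean_space"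
  assumes "indep_family C (\<lambda>c. r c p)" "\<And>c. c \<in> C \<Longrightarrow> (r c \<longlongrightarrow> r c p) (nhds p)"
  shows "\<forall>\<^sub>F q in nhds p. indep_family C (\<lambda>c. r c q)"
proof -
  define Z where "Z = {x :: real^'c. \<forall>c. c \<notin> C \<longrightarrow> x $ c = 0}"
  define T where "T = (\<lambda>q (x :: real^'c). \<Sum>c\<in>C. x $ c *\<^sub>R r c q)"
  have sub: "subspace Z"
    by (auto simp: Z_def subspace_def)
  have lin: "bounded_linear (T q)" for q
    unfolding T_def linear_conv_bounded_linear[symmetric]
    by (intro linearI) (simp_all add: scaleR_add_left sum.distrib scaleR_sum_right)
  have "\<forall>x\<in>Z. T p x = 0 \<longrightarrow> x = 0"
  proof (intro ballI impI)
    fix x assume "x \<in> Z" "T p x = 0"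
    then have "x $ c = 0" for c
      using indep_familyD[OF assms(1), of "\<lambda>c. x $ c" c] by (cases "c \<in> C") (auto simp: Z_def T_def)
    then show "x = 0" by (simp add: vec_eq_iff)
  qed
  from injective_imp_isometric[OF closed_subspace[OF sub] sub lin this]
  obtain e where e: "e > 0" "\<And>x. x \<in> Z \<Longrightarrow> e * norm x \<le> norm (T p x)"
    by (auto simp: mult.commute)
  have "((\<lambda>q. \<Sum>c\<in>C. norm (r c q - r c p)) \<longlongrightarrow> (\<Sum>c\<in>C. norm (r c p - r c p))) (nhds p)"
    by (intro tendsto_intros assms(2))
  then have "\<forall>\<^sub>F q in nhds p. (\<Sum>c\<in>C. norm (r c q - r c p)) < e"
    using e(1) by (intro order_tendstoD(2)) auto
  then show ?thesis
  proof eventually_elim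
    case (elim q)
    show ?case
      unfolding indep_family_def
    proof (intro allI impI ballI)
      fix l c assume l: "(\<Sum>c\<in>C. l c *\<^sub>R r c q) = 0" and c: "c \<in> C"
      define x :: "real^'c" where "x = (\<chi> c. if c \<in> C then l c else 0)"
      have xZ: "x \<in> Z" by (simp add: x_def Z_def)
      have "T q x = 0" using l by (simp add: T_def x_def)
      then have "T p x = (\<Sum>c\<in>C. x $ c *\<^sub>R (r c p - r c q))"
        by (simp add: T_def scaleR_diff_right sum_subtractf)
      then have "norm (T p x) \<le> (\<Sum>c\<in>C. norm (x $ c *\<^sub>R (r c p - r c q)))"
        by (simp only: norm_sum)
      also have "\<dots> \<le> (\<Sum>c\<in>C. norm x * norm (r c q - r c p))"
        by (intro sum_mono)
          (metis Finite_Cartesian_Product.norm_nth_le mult_right_mono norm_ge_zero norm_minus_commute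
            norm_scaleR real_norm_def)
      finally have "e * norm x \<le> norm x * (\<Sum>c\<in>C. norm (r c q - r c p))"
        using e(2)[OF xZ] by (simp add: sum_distrib_left)
      with elim have "norm x = 0"
        by (smt (verit, best) mult.commute mult_le_cancel_right norm_ge_zero)
      then have "x $ c = 0" by simp
      then show "l c = 0" using c by (simp add: x_def)
    qed
  qed
qed

text \<open>A first-order motion \<open>u\<close> of independent constraints extends to a curve in their common level set.
  With a family \<open>w\<close> dual to the gradients at \<open>p\<close>, the map \<open>f\<close> below has the identity as its derivative
  at \<open>p\<close>, hence is locally invertible, and its inner product with the gradient of \<open>g c\<close> at \<open>p\<close> is \<open>g c\<close>
  itself. The preimage of the straight line through \<open>f p\<close> with direction \<open>u\<close> therefore stays in the
  level set.\<close>

lemma constraint_curve: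
  fixes g :: "'c \<Rightarrow> 'a::euclidean_space \<Rightarrow> real" and r :: "'c \<Rightarrow> 'a \<Rightarrow> 'a"
  assumes "finite C"
    and der: "\<And>c q. c \<in> C \<Longrightarrow> (g c has_derivative (\<lambda>u. r c q \<bullet> u)) (at q)"
    and cont: "\<And>c. c \<in> C \<Longrightarrow> continuous_on UNIV (r c)"
    and indep: "indep_family C (\<lambda>c. r c p)"
    and u: "\<And>c. c \<in> C \<Longrightarrow> r c p \<bullet> u = 0"
  obtains \<gamma> \<delta> where "0 < \<delta>" "\<gamma> 0 = p" "(\<gamma> has_vector_derivative u) (at 0)"
    "\<And>t. \<bar>t\<bar> < \<delta> \<Longrightarrow> \<gamma> differentiable (at t)"
    "\<And>t c. \<bar>t\<bar> < \<delta> \<Longrightarrow> c \<in> C \<Longrightarrow> g c (\<gamma> t) = g c p"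
proof -
  have "\<forall>c\<in>C. \<exists>w. r c p \<bullet> w = 1 \<and> (\<forall>k\<in>C. k \<noteq> c \<longrightarrow> r k p \<bullet> w = 0)"
    using indep_family_dual_vector[OF indep \<open>finite C\<close>] by metis
  then obtain w where w: "\<And>c k. c \<in> C \<Longrightarrow> k \<in> C \<Longrightarrow> r k p \<bullet> w c = (if k = c then 1 else 0)"
    by metis
  define f where "f q = q + (\<Sum>c\<in>C. (g c q - r c p \<bullet> q) *\<^sub>R w c)" for q
  define f' where "f' q v = v + (\<Sum>c\<in>C. (r c q \<bullet> v - r c p \<bullet> v) *\<^sub>R w c)" for q v
  define F' where "F' q = id_blinfun +
    (\<Sum>c\<in>C. blinfun_scaleR_left (w c) o\<^sub>L (blinfun_inner_left (r c q) - blinfun_inner_left (r c p)))" for q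
  have F': "blinfun_apply (F' q) = f' q" for q
    by (rule ext) (simp add: F'_def f'_def blinfun.bilinear_simps blinfun.sum_left inner_commute)
  have f_der: "(f has_derivative f' q) (at q)" for q
    unfolding f_def f'_def using der by (auto intro!: derivative_eq_intros)
  have Fp: "F' p = id_blinfun"
    by (simp add: F'_def)
  have "continuous_on UNIV F'"
    unfolding F'_def using cont by (auto intro!: continuous_intros)
  moreover have "id_blinfun o\<^sub>L F' p = id_blinfun"
    unfolding Fp by (rule blinfun_eqI) simp
  ultimately obtain U V k k' where k: "open V" "f p \<in> V" "homeomorphism U V f k" "p \<in> U"
      "\<And>y. y \<in> V \<Longrightarrow> (k has_derivative (k' y)) (at y)"
      "\<And>y. y \<in> V \<Longrightarrow> k' y = inv (blinfun_apply (F' (k y)))"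
    using inverse_function_theorem[of UNIV f F' p id_blinfun] f_der F' by (metis UNIV_I open_UNIV)
  have kp: "k (f p) = p"
    using k(3,4) by (simp add: homeomorphism_def)
  have key: "r c p \<bullet> f q = g c q" if "c \<in> C" for c q
  proof -
    have "r c p \<bullet> f q = r c p \<bullet> q + (\<Sum>x\<in>C. (g x q - r x p \<bullet> q) * (r c p \<bullet> w x))"
      by (simp add: f_def inner_add_right inner_sum_right)
    also have "(\<Sum>x\<in>C. (g x q - r x p \<bullet> q) * (r c p \<bullet> w x))
        = (\<Sum>x\<in>C. if x = c then g x q - r x p \<bullet> q else 0)"
      using w that by (intro sum.cong) auto
    finally show ?thesis
      using that \<open>finite C\<close> by simp
  qed
  define l where "l t = f p + t *\<^sub>R u" for t :: real
  have l: "(l has_vector_derivative u) (at t)" for t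
    unfolding l_def by (auto intro!: derivative_eq_intros)
  have "isCont l 0"
    using l has_vector_derivative_continuous by blast
  then have "(l \<longlongrightarrow> f p) (at 0)"
    unfolding continuous_at by (simp add: l_def[of 0])
  then have "\<forall>\<^sub>F t in at 0. l t \<in> V"
    using k(1,2) by (rule topological_tendstoD)
  then obtain \<delta> where \<delta>: "\<delta> > 0" "\<And>t. \<bar>t\<bar> < \<delta> \<Longrightarrow> l t \<in> V"
    using k(2) by (auto simp: eventually_at dist_real_def l_def) (metis add_0_right scaleR_zero_left)
  show ?thesis
  proof
    show "0 < \<delta>" by fact
    show "(k \<circ> l) 0 = p" using kp by (simp add: l_def)
    have kd: "k' (f p) = id"
      using k(6)[OF k(2)] kp Fp by (simp add: inv_id[unfolded id_def] id_def)
    have "((k \<circ> l) has_vector_derivative k' (f p) u) (at 0)"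
      using vector_derivative_diff_chain_within[OF l[of 0], of k "k' (f p)"] k(5)[OF k(2)]
      by (simp add: l_def has_derivative_at_withinI)
    then show "((k \<circ> l) has_vector_derivative u) (at 0)"
      by (simp add: kd)
    show "(k \<circ> l) differentiable (at t)" if "\<bar>t\<bar> < \<delta>" for t
    proof (rule differentiable_chain_at)
      show "l differentiable (at t)"
        using l[of t] by (auto simp: has_vector_derivative_def differentiable_def)
      show "k differentiable (at (l t))"
        using k(5)[OF \<delta>(2)[OF that]] by (auto simp: differentiable_def)
    qed
    show "g c ((k \<circ> l) t) = g c p" if "\<bar>t\<bar> < \<delta>" "c \<in> C" for t c
    proof -
      have "f (k (l t)) = l t"
        using k(3) \<delta>(2)[OF that(1)] by (simp add: homeomorphism_def)
      then have "g c (k (l t)) = r c p \<bullet> l t"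
        using key[OF that(2), of "k (l t)"] by simp
      also have "\<dots> = r c p \<bullet> f p"
        using u[OF that(2)] by (simp add: l_def inner_add_right)
      finally show ?thesis using key[OF that(2), of p] by simp
    qed
  qed
qed

section \<open>Edge lengths and infinitesimal motions\<close>

text \<open>A row of the rigidity matrix. The double sum over the edge avoids choosing an order of its
  end points \<open>i, j\<close>; the row has the entries \<open>q i - q j\<close> and \<open>q j - q i\<close>.\<close>

definition edge_row :: "(real^3)^'v \<Rightarrow> 'v::finite set \<Rightarrow> (real^3)^'v" where
  "edge_row q e = (\<chi> i. if i \<in> e then \<Sum>j\<in>e. q $ i - q $ j else 0)"

text \<open>Normalised so that the gradient is \<open>edge_row\<close>; on an edge with two end points it is half of
  the squared length, because each pair is counted twice.\<close>

definition edge_energy :: "'v::finite set \<Rightarrow> (real^3)^'v \<Rightarrow> real" where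
  "edge_energy e q = (\<Sum>i\<in>e. \<Sum>j\<in>e. (q $ i - q $ j) \<bullet> (q $ i - q $ j)) / 4"

lemma inner_edge_row: "edge_row q e \<bullet> u = (\<Sum>i\<in>e. \<Sum>j\<in>e. (q $ i - q $ j) \<bullet> (u $ i - u $ j)) / 2"
proof -
  have "edge_row q e \<bullet> u = (\<Sum>i\<in>UNIV. if i \<in> e then (\<Sum>j\<in>e. q $ i - q $ j) \<bullet> u $ i else 0)"
    unfolding inner_vec_def edge_row_def by (intro sum.cong) auto
  also have "\<dots> = (\<Sum>i\<in>e. \<Sum>j\<in>e. (q $ i - q $ j) \<bullet> u $ i)"
    by (simp add: sum.If_cases inner_sum_left)
  finally have 1: "edge_row q e \<bullet> u = (\<Sum>i\<in>e. \<Sum>j\<in>e. (q $ i - q $ j) \<bullet> u $ i)" .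
  also have "\<dots> = (\<Sum>j\<in>e. \<Sum>i\<in>e. (q $ i - q $ j) \<bullet> u $ i)"
    by (rule sum.swap)
  also have "\<dots> = - (\<Sum>i\<in>e. \<Sum>j\<in>e. (q $ i - q $ j) \<bullet> u $ j)"
    unfolding sum_negf[symmetric] inner_minus_left[symmetric] by simp
  finally show ?thesis
    using 1 by (simp add: inner_diff_right sum_subtractf)
qed

lemma inner_edge_row_doubleton:
  "edge_row q {i, j} \<bullet> u = (q $ i - q $ j) \<bullet> (u $ i - u $ j)"
proof (cases "i = j")
  case False
  have "(q $ j - q $ i) \<bullet> (u $ j - u $ i) = (q $ i - q $ j) \<bullet> (u $ i - u $ j)"
    by (simp add: inner_diff_left inner_diff_right)
  with False show ?thesis by (simp add: inner_edge_row)
qed (simp add: inner_edge_row)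

lemma edge_sq_length_eq_energy:
  assumes "card e = 2"
  shows "edge_sq_length q e = 2 * edge_energy e q"
proof -
  obtain i j where e: "e = {i, j}" "i \<noteq> j"
    using assms by (auto simp: card_2_iff)
  have "(q $ j - q $ i) \<bullet> (q $ j - q $ i) = (q $ i - q $ j) \<bullet> (q $ i - q $ j)"
    by (simp add: inner_diff_left inner_diff_right)
  with e show ?thesis
    by (simp add: edge_sq_length_doubleton edge_energy_def power2_norm_eq_inner)
qed

text \<open>A quadratic function changes by exactly its derivative at the midpoint. This turns the comparison
  of two placements into a question about an infinitesimal motion of the placement halfway between.\<close>

lemma edge_energy_diff:
  "edge_energy e q - edge_energy e p = edge_row ((1/2) *\<^sub>R (p + q)) e \<bullet> (q - p)"
proof -
  have *: "(q $ i - q $ j) \<bullet> (q $ i - q $ j) - (p $ i - p $ j) \<bullet> (p $ i - p $ j) =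
    2 * ((((1/2) *\<^sub>R (p + q)) $ i - ((1/2) *\<^sub>R (p + q)) $ j) \<bullet> ((q - p) $ i - (q - p) $ j))" for i j
    by (simp add: algebra_simps inner_diff_left inner_diff_right inner_add_left inner_add_right
        inner_commute)
  show ?thesis
    unfolding edge_energy_def inner_edge_row diff_divide_distrib[symmetric] sum_subtractf[symmetric] *
      sum_distrib_left[symmetric] by simp
qed

lemma has_derivative_vec_nth: "((\<lambda>q. q $ i) has_derivative (\<lambda>u. u $ i)) (at q within s)"
  by (intro bounded_linear_imp_has_derivative bounded_linear_vec_nth)

lemma has_derivative_edge_energy: "(edge_energy e has_derivative (\<lambda>u. edge_row q e \<bullet> u)) (at q)"
proof -
  have "(edge_energy e has_derivative
      (\<lambda>u. (\<Sum>i\<in>e. \<Sum>j\<in>e. (q $ i - q $ j) \<bullet> (u $ i - u $ j) + (u $ i - u $ j) \<bullet> (q $ i - q $ j)) / 4)) (at q)"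
    unfolding edge_energy_def[abs_def]
    by (auto intro!: derivative_eq_intros has_derivative_vec_nth)
  also have "(\<lambda>u. (\<Sum>i\<in>e. \<Sum>j\<in>e. (q $ i - q $ j) \<bullet> (u $ i - u $ j) + (u $ i - u $ j) \<bullet> (q $ i - q $ j)) / 4)
      = (\<lambda>u. edge_row q e \<bullet> u)"
    unfolding inner_edge_row
    by (simp add: inner_commute fun_eq_iff mult_2[symmetric] sum_distrib_left[symmetric])
  finally show ?thesis .
qed

lemma continuous_edge_row: "continuous_on UNIV (\<lambda>q. edge_row q e)"
proof -
  have "continuous_on UNIV (\<lambda>q::(real^3)^'a. if i \<in> e then \<Sum>j\<in>e. q $ i - q $ j else 0)" for i
    by (cases "i \<in> e") (auto intro!: continuous_intros)
  then show ?thesis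
    unfolding edge_row_def by (intro continuous_on_vec_lambda)
qed

text \<open>Independence of the edge rows as functionals on tangential velocities, for a given field
  \<open>\<nu>\<close> of normals. It is equivalent to independence of the edge rows together with
  all normals (\<open>indep_family_iff_tangential\<close>), and it is the form in which configurations on
  different surfaces can be compared.\<close>

definition tangentially_independent ::
    "(real^3 \<Rightarrow> real^3) \<Rightarrow> 'v::finite set set \<Rightarrow> (real^3)^'v \<Rightarrow> bool" where
  "tangentially_independent \<nu> F q \<longleftrightarrow>
     (\<forall>l. (\<forall>z. (\<forall>i. \<nu> (q $ i) \<bullet> z $ i = 0) \<longrightarrow> (\<Sum>e\<in>F. l e * (edge_row q e \<bullet> z)) = 0) \<longrightarrow>
       (\<forall>e\<in>F. l e = 0))"

text \<open>The rows of the edges, and of the vertices in the directions in which they are held on the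
  surface.\<close>

fun normal_row :: "(real^3 \<Rightarrow> real^3) \<Rightarrow> 'v::finite set + 'v \<Rightarrow> (real^3)^'v \<Rightarrow> (real^3)^'v" where
  "normal_row \<nu> (Inl e) q = edge_row q e"
| "normal_row \<nu> (Inr i) q = axis i (\<nu> (q $ i))"

lemma parallel_of_perp_perp:
  fixes n x :: "'a::real_inner"
  assumes "n \<noteq> 0" "\<And>z. n \<bullet> z = 0 \<Longrightarrow> x \<bullet> z = 0"
  shows "x = ((x \<bullet> n) / (n \<bullet> n)) *\<^sub>R n"
proof -
  let ?z = "x - ((x \<bullet> n) / (n \<bullet> n)) *\<^sub>R n"
  have nz: "n \<bullet> ?z = 0"
    using assms(1) by (simp add: inner_diff_right inner_commute)
  then have "?z \<bullet> ?z = 0"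
    using assms(2)[OF nz] by (simp add: inner_diff_left)
  then show ?thesis by simp
qed

lemma sum_normal_row_nth:
  "(\<Sum>c\<in>F <+> W. l c *\<^sub>R normal_row \<nu> c q) $ i =
     (\<Sum>e\<in>F. l (Inl e) *\<^sub>R edge_row q e $ i) + (if i \<in> W then l (Inr i) *\<^sub>R \<nu> (q $ i) else 0)"
proof -
  have "(\<Sum>c\<in>F <+> W. l c *\<^sub>R normal_row \<nu> c q) =
      (\<Sum>e\<in>F. l (Inl e) *\<^sub>R edge_row q e) + (\<Sum>j\<in>W. l (Inr j) *\<^sub>R axis j (\<nu> (q $ j)))"
    by (simp add: sum.Plus)
  moreover have "(\<Sum>j\<in>W. l (Inr j) *\<^sub>R axis j (\<nu> (q $ j))) $ i =
      (\<Sum>j\<in>W. if j = i then l (Inr j) *\<^sub>R \<nu> (q $ j) else 0)"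
    unfolding sum_component by (intro sum.cong) (auto simp: axis_def)
  ultimately show ?thesis by (simp add: sum_component)
qed

text \<open>A combination of edge rows vanishes on all tangential velocities exactly when each of its
  components is a multiple of the normal there, that is, when normals cancel it.\<close>

lemma indep_family_iff_tangential:
  fixes q :: "(real^3)^'v::finite"
  assumes n: "\<And>i. \<nu> (q $ i) \<noteq> 0"
  shows "indep_family (F <+> UNIV) (\<lambda>c. normal_row \<nu> c q) \<longleftrightarrow> tangentially_independent \<nu> F q"
proof
  assume ind: "indep_family (F <+> UNIV) (\<lambda>c. normal_row \<nu> c q)"
  show "tangentially_independent \<nu> F q"
    unfolding tangentially_independent_def
  proof (intro allI impI ballI)
    fix l e assume l: "\<forall>z. (\<forall>i. \<nu> (q $ i) \<bullet> z $ i = 0) \<longrightarrow> (\<Sum>e\<in>F. l e * (edge_row q e \<bullet> z)) = 0"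
      and e: "e \<in> F"
    define x where "x = (\<Sum>e\<in>F. l e *\<^sub>R edge_row q e)"
    have x: "x \<bullet> z = (\<Sum>e\<in>F. l e * (edge_row q e \<bullet> z))" for z
      by (simp add: x_def inner_sum_left)
    define m where "m i = (x $ i \<bullet> \<nu> (q $ i)) / (\<nu> (q $ i) \<bullet> \<nu> (q $ i))" for i
    have m: "x $ i = m i *\<^sub>R \<nu> (q $ i)" for i
      unfolding m_def
    proof (rule parallel_of_perp_perp)
      fix z assume z: "\<nu> (q $ i) \<bullet> z = 0"
      have "\<forall>j. \<nu> (q $ j) \<bullet> axis i z $ j = 0"
        using z by (simp add: axis_def)
      then have "x \<bullet> axis i z = 0" using l x by metis
      then show "x $ i \<bullet> z = 0" by (simp add: inner_axis)
    qed (fact n)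
    define l' where "l' c = (case c of Inl e \<Rightarrow> l e | Inr i \<Rightarrow> - m i)" for c
    have "(\<Sum>c\<in>F <+> UNIV. l' c *\<^sub>R normal_row \<nu> c q) = 0"
      unfolding vec_eq_iff sum_normal_row_nth using m by (simp add: l'_def x_def sum_component)
    from indep_familyD[OF ind this, of "Inl e"] e show "l e = 0"
      by (simp add: l'_def InlI)
  qed
next
  assume ind: "tangentially_independent \<nu> F q"
  show "indep_family (F <+> UNIV) (\<lambda>c. normal_row \<nu> c q)"
    unfolding indep_family_def
  proof (intro allI impI ballI)
    fix l c assume l: "(\<Sum>c\<in>F <+> UNIV. l c *\<^sub>R normal_row \<nu> c q) = 0" and c: "c \<in> F <+> (UNIV :: 'v set)"
    have "(\<Sum>e\<in>F. l (Inl e) * (edge_row q e \<bullet> z)) = 0" if z: "\<forall>i. \<nu> (q $ i) \<bullet> z $ i = 0" for z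
    proof -
      have "(\<Sum>c\<in>F <+> UNIV. l c *\<^sub>R normal_row \<nu> c q) \<bullet> z = (\<Sum>e\<in>F. l (Inl e) * (edge_row q e \<bullet> z))"
        using z by (simp add: sum.Plus inner_add_left inner_sum_left inner_axis')
      with l show ?thesis by simp
    qed
    then have lF: "\<forall>e\<in>F. l (Inl e) = 0"
      using ind[unfolded tangentially_independent_def, rule_format, of "\<lambda>e. l (Inl e)"] by blast
    have "l (Inr i) *\<^sub>R \<nu> (q $ i) = 0" for i
      using arg_cong[OF l, of "\<lambda>x. x $ i"] lF unfolding sum_normal_row_nth by simp
    with n have "l (Inr i) = 0" for i by simp
    with lF c show "l c = 0" by auto
  qed
qed

unbundle cross3_syntax

section \<open>Parallel planes and concentric spheres as level sets\<close>

text \<open>Planes orthogonal to \<open>d\<close> are the level sets of \<open>d \<bullet> x\<close>, and spheres with centre \<open>- d\<close> are those of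
  \<open>(x \<bullet> x) / 2 + d \<bullet> x\<close>. With \<open>\<epsilon> = 0\<close> or \<open>\<epsilon> = 1\<close> both cases become levels of one potential, which is at most
  quadratic with an affine gradient, and the whole rigidity argument is carried out for it. \<open>T\<close> is the
  finite set of levels that occur.\<close>

locale surface_family =
  fixes \<epsilon> :: real and d :: "real^3" and T :: "real set"
  assumes eps: "\<epsilon> = 1 \<or> \<epsilon> = 0 \<and> d \<noteq> 0"
    and finite_levels: "finite T"
    and noncritical: "\<And>x. (\<epsilon> / 2) * (x \<bullet> x) + d \<bullet> x \<in> T \<Longrightarrow> \<epsilon> *\<^sub>R x + d \<noteq> 0"
begin

definition normal :: "real^3 \<Rightarrow> real^3" where
  "normal x = \<epsilon> *\<^sub>R x + d"

definition potential :: "real^3 \<Rightarrow> real" where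
  "potential x = (\<epsilon> / 2) * (x \<bullet> x) + d \<bullet> x"

definition surface :: "(real^3) set" where
  "surface = {x. potential x \<in> T}"

abbreviation gradient :: "'v::finite set + 'v \<Rightarrow> (real^3)^'v \<Rightarrow> (real^3)^'v" where
  "gradient \<equiv> normal_row normal"

fun constraint :: "'v::finite set + 'v \<Rightarrow> (real^3)^'v \<Rightarrow> real" where
  "constraint (Inl e) q = edge_energy e q"
| "constraint (Inr i) q = potential (q $ i)"

lemma normal_nonzero: "x \<in> surface \<Longrightarrow> normal x \<noteq> 0"
  using noncritical by (auto simp: surface_def potential_def normal_def)

lemma potential_diff: "potential y - potential x = normal ((1/2) *\<^sub>R (x + y)) \<bullet> (y - x)"
  by (simp add: potential_def normal_def algebra_simps inner_diff_right inner_add_left inner_commute)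

text \<open>The inner products of normals and of difference vectors are functions of the levels and of the
  distances. This makes congruent placements on the surface determine the same frames.\<close>

lemma normal_inner_normal: "normal x \<bullet> normal x = 2 * \<epsilon> * potential x + d \<bullet> d"
  using eps by (auto simp: normal_def potential_def inner_add_left inner_add_right inner_commute)

lemma normal_inner_diff:
  "normal x \<bullet> (y - x) = potential y - potential x - (\<epsilon> / 2) * ((y - x) \<bullet> (y - x))"
  by (simp add: potential_def normal_def algebra_simps inner_diff_right inner_diff_left
      inner_add_left inner_commute)

lemma continuous_on_normal: "continuous_on UNIV normal"
  unfolding normal_def by (intro continuous_intros)

lemma continuous_on_potential: "continuous_on UNIV potential"
  unfolding potential_def by (intro continuous_intros)

lemma has_derivative_potential: "(potential has_derivative (\<lambda>u. normal x \<bullet> u)) (at x)"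
proof -
  have "(potential has_derivative (\<lambda>u. (\<epsilon> / 2) * (x \<bullet> u + u \<bullet> x) + d \<bullet> u)) (at x)"
    unfolding potential_def[abs_def] by (auto intro!: derivative_eq_intros)
  also have "(\<lambda>u. (\<epsilon> / 2) * (x \<bullet> u + u \<bullet> x) + d \<bullet> u) = (\<lambda>u. normal x \<bullet> u)"
    by (auto simp: normal_def inner_add_left inner_add_right inner_commute)
  finally show ?thesis .
qed

lemma constraint_diff:
  "constraint c q - constraint c p = gradient c ((1/2) *\<^sub>R (p + q)) \<bullet> (q - p)"
  by (cases c) (simp_all add: edge_energy_diff potential_diff inner_axis')

lemma has_derivative_constraint: "(constraint c has_derivative (\<lambda>u. gradient c q \<bullet> u)) (at q)"
proof (cases c)
  case (Inl e)
  then have "constraint c = edge_energy e" by auto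
  then show ?thesis using Inl has_derivative_edge_energy by simp
next
  case (Inr i)
  then have "constraint c = (\<lambda>q. potential (q $ i))" by auto
  moreover have "((\<lambda>q. potential (q $ i)) has_derivative (\<lambda>u. normal (q $ i) \<bullet> u $ i)) (at q)"
    using has_derivative_compose[OF has_derivative_vec_nth has_derivative_potential] .
  ultimately show ?thesis using Inr by (simp add: inner_axis')
qed

lemma continuous_gradient: "continuous_on UNIV (gradient c)"
proof (cases c)
  case (Inl e)
  then have "gradient c = (\<lambda>q. edge_row q e)" by auto
  then show ?thesis using continuous_edge_row by simp
next
  case (Inr i)
  then have "gradient c = (\<lambda>q. \<chi> j. if j = i then normal (q $ i) else 0)"
    by (auto simp: axis_def)
  moreover have "continuous_on UNIV (\<lambda>q::(real^3)^'a. if j = i then normal (q $ i) else 0)" for j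
    by (cases "j = i")
      (auto intro!: continuous_intros continuous_on_compose2[OF continuous_on_normal])
  ultimately show ?thesis by (simp add: continuous_on_vec_lambda)
qed

lemma tendsto_gradient: "(gradient c \<longlongrightarrow> gradient c p) (nhds p)"
  using continuous_gradient[of c] by (simp add: continuous_on_eq_continuous_at isCont_def tendsto_nhds_iff)

lemma eventually_indep_gradients:
  "indep_family C (\<lambda>c. gradient c p) \<Longrightarrow> \<forall>\<^sub>F q in nhds p. indep_family C (\<lambda>c. gradient c q)"
  by (rule eventually_indep_family) (auto simp: tendsto_gradient)

text \<open>The length of the segment from \<open>x\<close> to \<open>y\<close> is a noncritical function of the end points on the
  surface: the segment is not normal to a plane, or not on a line through the centre.\<close>

definition nondegenerate :: "real^3 \<Rightarrow> real^3 \<Rightarrow> bool" where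
  "nondegenerate x y \<longleftrightarrow> normal x \<times> (x - y) \<noteq> 0"

lemma normal_diff: "normal x - normal y = \<epsilon> *\<^sub>R (x - y)"
  by (simp add: normal_def scaleR_diff_right)

lemma nondegenerate_commute: "nondegenerate x y \<longleftrightarrow> nondegenerate y x"
proof -
  have "normal y = normal x - \<epsilon> *\<^sub>R (x - y)" and "y - x = - (x - y)"
    by (simp_all flip: normal_diff)
  then have "normal y \<times> (y - x) = - (normal x \<times> (x - y))"
    by (simp only: Cross3.left_diff_distrib cross_mult_left cross_minus_right cross_refl) simp
  then show ?thesis by (simp add: nondegenerate_def)
qed

lemma parallel_of_cross_zero:
  fixes n x :: "real^3"
  assumes "n \<times> x = 0" "n \<noteq> 0"
  obtains s where "x = s *\<^sub>R n"
proof
  have "n \<times> (n \<times> x) = 0" using assms by simp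
  then have "(n \<bullet> n) *\<^sub>R x = (n \<bullet> x) *\<^sub>R n" by (simp add: Lagrange)
  then have "(1 / (n \<bullet> n)) *\<^sub>R ((n \<bullet> n) *\<^sub>R x) = (1 / (n \<bullet> n)) *\<^sub>R ((n \<bullet> x) *\<^sub>R n)" by simp
  then show "x = ((n \<bullet> x) / (n \<bullet> n)) *\<^sub>R n" using assms(2) by simp
qed

lemma nondegenerate_of_indep:
  assumes ind: "indep_family ({{a, b}} <+> W) (\<lambda>c. gradient c q)" and ab: "a \<in> W" "b \<in> W" "finite W"
    and n: "normal (q $ a) \<noteq> 0" "normal (q $ b) \<noteq> 0"
  shows "nondegenerate (q $ a) (q $ b)"
proof (rule ccontr)
  have fin: "finite ({{a, b}} <+> W)" using ab by simp
  obtain w where w: "gradient (Inl {a, b}) q \<bullet> w = 1"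
    "\<And>k. k \<in> {{a, b}} <+> W \<Longrightarrow> k \<noteq> Inl {a, b} \<Longrightarrow> gradient k q \<bullet> w = 0"
    using indep_family_dual_vector[OF ind fin, of "Inl {a, b}"] by auto
  have wa: "normal (q $ a) \<bullet> w $ a = 0" and wb: "normal (q $ b) \<bullet> w $ b = 0"
    using w(2)[of "Inr a"] w(2)[of "Inr b"] ab by (auto simp: inner_axis')
  assume 0: "\<not> nondegenerate (q $ a) (q $ b)"
  then obtain s where s: "q $ a - q $ b = s *\<^sub>R normal (q $ a)"
    using parallel_of_cross_zero n(1) unfolding nondegenerate_def by metis
  from 0 obtain t where t: "q $ b - q $ a = t *\<^sub>R normal (q $ b)"
    using parallel_of_cross_zero n(2) nondegenerate_commute unfolding nondegenerate_def by metis
  have "(q $ a - q $ b) \<bullet> (w $ a - w $ b) = (q $ a - q $ b) \<bullet> w $ a + (q $ b - q $ a) \<bullet> w $ b"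
    by (simp add: inner_diff_left inner_diff_right)
  also have "\<dots> = 0" unfolding s t using wa wb by simp
  finally show False using w(1) by (simp add: inner_edge_row_doubleton)
qed

lemma indep_of_nondegenerate:
  assumes nd: "nondegenerate (q $ a) (q $ b)" and n: "\<And>i. normal (q $ i) \<noteq> 0"
  shows "indep_family ({{a, b}} <+> UNIV) (\<lambda>c. gradient c q)"
  unfolding indep_family_iff_tangential[where \<nu> = normal and q = q, OF n] tangentially_independent_def
proof (intro allI impI ballI)
  fix l e assume l: "\<forall>z. (\<forall>i. normal (q $ i) \<bullet> z $ i = 0) \<longrightarrow>
      (\<Sum>e\<in>{{a, b}}. l e * (edge_row q e \<bullet> z)) = 0" and e: "e \<in> {{a, b}}"
  let ?n = "normal (q $ a)" and ?x = "q $ a - q $ b"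
  let ?z = "axis a ((?n \<times> ?x) \<times> ?n)"
  have ab: "a \<noteq> b" using nd by (auto simp: nondegenerate_def)
  have "\<forall>i. normal (q $ i) \<bullet> ?z $ i = 0"
    by (simp add: axis_def dot_cross_self)
  with l have "l {a, b} * (edge_row q {a, b} \<bullet> ?z) = 0" by simp
  moreover have "edge_row q {a, b} \<bullet> ?z = ?x \<bullet> ((?n \<times> ?x) \<times> ?n)"
    using ab by (simp add: inner_edge_row_doubleton axis_def)
  moreover have "?x \<bullet> ((?n \<times> ?x) \<times> ?n) = (?n \<times> ?x) \<bullet> (?n \<times> ?x)"
    using cross_triple[of "?n \<times> ?x" ?n ?x] by (simp add: inner_commute)
  ultimately show "l e = 0"
    using nd e by (simp add: nondegenerate_def)
qed

section \<open>Isometries of the surface and the count of constraints\<close>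

text \<open>The rigid velocity fields \<open>w \<times> x + t\<close> that are tangent to all level sets of the potential: for planes,
  the translations along them and the rotations about a normal axis; for spheres, the rotations about
  the centre. As the condition does not involve the levels, the fields are tangential at midpoints of
  two placements as well, although these lie on other levels.\<close>

definition killing_pairs :: "((real^3) \<times> (real^3)) set" where
  "killing_pairs = {(w, t). \<epsilon> *\<^sub>R t = w \<times> d \<and> t \<bullet> d = 0}"

definition killing_motion :: "'v::finite set \<Rightarrow> (real^3)^'v \<Rightarrow> (real^3) \<times> (real^3) \<Rightarrow> (real^3)^'v" where
  "killing_motion W q k = (\<chi> i. if i \<in> W then fst k \<times> q $ i + snd k else 0)"

lemma cross_normal: "(w, t) \<in> killing_pairs \<Longrightarrow> w \<times> normal x = \<epsilon> *\<^sub>R (w \<times> x + t)"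
  by (simp add: killing_pairs_def normal_def cross_add_right cross_mult_right scaleR_add_right)

lemma normal_inner_killing:
  assumes "(w, t) \<in> killing_pairs"
  shows "normal x \<bullet> (w \<times> x + t) = 0"
proof -
  have "normal x \<bullet> (w \<times> x + t) = x \<bullet> (\<epsilon> *\<^sub>R t) + d \<bullet> (w \<times> x) + t \<bullet> d"
    by (simp add: normal_def inner_add_left inner_add_right dot_cross_self inner_commute)
  also have "x \<bullet> (\<epsilon> *\<^sub>R t) = x \<bullet> (w \<times> d)" using assms by (simp add: killing_pairs_def)
  also have "\<dots> = - (d \<bullet> (w \<times> x))" by (simp add: cross3_simps)
  finally show ?thesis using assms by (simp add: killing_pairs_def)
qed

lemma gradient_inner_killing:
  assumes "k \<in> killing_pairs" "c \<in> F <+> W" "\<And>e. e \<in> F \<Longrightarrow> e \<subseteq> W \<and> card e = 2"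
  shows "gradient c q \<bullet> killing_motion W q k = 0"
  using assms(2)
proof (rule PlusE)
  fix e assume e: "e \<in> F" "c = Inl e"
  with assms(3) obtain i j where ij: "e = {i, j}" "i \<noteq> j" "i \<in> W" "j \<in> W"
    by (auto simp: card_2_iff) (metis insert_subset card_2_iff)
  have "killing_motion W q k $ i - killing_motion W q k $ j = fst k \<times> (q $ i - q $ j)"
    using ij by (simp add: killing_motion_def Cross3.right_diff_distrib)
  then show ?thesis
    using e ij by (simp add: inner_edge_row_doubleton dot_cross_self)
next
  fix i assume "i \<in> W" "c = Inr i"
  then show ?thesis
    using normal_inner_killing[of "fst k" "snd k" "q $ i"] assms(1)
    by (simp add: inner_axis' killing_motion_def)
qed

lemma subspace_killing_pairs: "subspace killing_pairs"
  by (auto simp: subspace_def killing_pairs_def zero_prod_def cross_add_left cross_mult_left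
      scaleR_add_right inner_add_left) (metis mult.commute scaleR_scaleR)

lemma linear_killing_motion: "linear (killing_motion W q)"
  by (intro linearI; rule vec_eq_iff[THEN iffD2])
    (simp_all add: killing_motion_def cross_add_left cross_mult_left scaleR_add_right)

lemma dim_killing_pairs: "3 \<le> dim killing_pairs"
proof -
  \<comment> \<open>Spheres: parametrised by the rotation vector.
    Planes: by a vector whose components along and across \<open>d\<close> give the rotation and the translation.\<close>
  obtain f :: "real^3 \<Rightarrow> (real^3) \<times> (real^3)" where f: "linear f" "inj f" "range f \<subseteq> killing_pairs"
  proof (cases "\<epsilon> = 1")
    case True
    show ?thesis
    proof (rule that[of "\<lambda>w. (w, w \<times> d)"])
      show "linear (\<lambda>w. (w, w \<times> d))"
        by (intro linearI) (auto simp: cross_add_left cross_mult_left)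
      show "range (\<lambda>w. (w, w \<times> d)) \<subseteq> killing_pairs"
        unfolding killing_pairs_def using True by (auto simp: dot_cross_self)
    qed (auto simp: inj_def)
  next
    case False
    then have d: "\<epsilon> = 0" "d \<noteq> 0" using eps by auto
    let ?f = "\<lambda>x. ((x \<bullet> d) *\<^sub>R d, x - ((x \<bullet> d) / (d \<bullet> d)) *\<^sub>R d)"
    show ?thesis
    proof (rule that[of ?f])
      show lin: "linear ?f"
        by (intro linearI) (auto simp: algebra_simps inner_add_left add_divide_distrib)
      show "inj ?f"
        unfolding linear_injective_0[OF lin] using d by (auto simp: zero_prod_def)
      show "range ?f \<subseteq> killing_pairs"
        unfolding killing_pairs_def using d by (auto simp: cross_mult_left inner_diff_left)
    qed
  qed
  have "dim (range f) = DIM(real^3)"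
    using dim_image_eq[OF f(1), of UNIV] f(2) by simp
  then show ?thesis
    using dim_subset[OF f(3)] by simp
qed

text \<open>A field that vanishes at both ends of a nondegenerate segment has its rotation vector parallel both
  to the normal and to the segment, so it is zero.\<close>

lemma dim_killing_motions:
  assumes nd: "nondegenerate (q $ a) (q $ b)" and ab: "a \<in> W" "b \<in> W"
  shows "3 \<le> dim (killing_motion W q ` killing_pairs)"
proof -
  have "inj_on (killing_motion W q) (span killing_pairs)"
    unfolding linear_injective_on_subspace_0[OF linear_killing_motion subspace_span]
  proof (intro ballI impI)
    fix k assume "k \<in> span killing_pairs" and k0: "killing_motion W q k = 0"
    then have kp: "k \<in> killing_pairs"
      using subspace_killing_pairs span_eq_iff by blast
    obtain w t where k: "k = (w, t)" by (cases k)
    have wt: "w \<times> q $ i + t = 0" if "i \<in> W" for i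
      using arg_cong[OF k0, of "\<lambda>x. x $ i"] that by (simp add: killing_motion_def k)
    let ?n = "normal (q $ a)" and ?x = "q $ a - q $ b"
    have wn: "w \<times> ?n = 0"
      using cross_normal[of w t "q $ a"] kp k wt[OF ab(1)] by simp
    have wx: "w \<times> ?x = 0"
      using wt[OF ab(1)] wt[OF ab(2)]
      by (metis Cross3.right_diff_distrib add_diff_cancel_right diff_self)
    have "w = 0"
    proof (rule ccontr)
      assume "w \<noteq> 0"
      then obtain s s' where "?n = s *\<^sub>R w" "?x = s' *\<^sub>R w"
        using parallel_of_cross_zero wn wx by metis
      then have "?n \<times> ?x = 0" by (simp add: cross_mult_left cross_mult_right)
      with nd show False by (simp add: nondegenerate_def)
    qed
    with wt[OF ab(1)] show "k = 0" by (simp add: k zero_prod_def)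
  qed
  then show ?thesis
    using dim_image_eq[OF linear_killing_motion] dim_killing_pairs by metis
qed

text \<open>Both the gradients and the infinitesimal isometries live on the \<open>3 |W|\<close>-dimensional space of
  velocities of the vertices in \<open>W\<close>, and they are orthogonal to each other there.\<close>

lemma indep_gradients_count:
  fixes q :: "(real^3)^'v::finite"
  assumes ind: "indep_family (F <+> W) (\<lambda>c. gradient c q)"
    and F: "\<And>e. e \<in> F \<Longrightarrow> e \<subseteq> W \<and> card e = 2" "F \<noteq> {}"
    and n: "\<And>i. i \<in> W \<Longrightarrow> normal (q $ i) \<noteq> 0"
  shows "card F + 3 \<le> 2 * card W"
proof -
  obtain a b where ab: "{a, b} \<in> F" "a \<in> W" "b \<in> W"
    using F by (metis all_not_in_conv card_2_iff insert_subset)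
  have sub: "indep_family ({{a, b}} <+> W) (\<lambda>c. gradient c q)"
    by (rule indep_family_mono[OF ind]) (use ab in auto)
  have nd: "nondegenerate (q $ a) (q $ b)"
    using nondegenerate_of_indep[OF sub ab(2,3)] ab(2,3) n by simp
  let ?R = "(\<lambda>c. gradient c q) ` (F <+> W)" and ?K = "killing_motion W q ` killing_pairs"
  define B :: "((real^3)^'v) set" where "B = (\<lambda>(i, b). axis i b) ` (SIGMA i:W. Basis)"
  have "finite B" unfolding B_def by (intro finite_imageI finite_SigmaI) auto
  have "card B \<le> card (SIGMA i:W. (Basis :: (real^3) set))"
    unfolding B_def by (intro card_image_le finite_SigmaI) auto
  then have "card B \<le> 3 * card W" by (simp add: mult.commute)
  have supp: "x \<in> span B" if x: "\<And>i. i \<notin> W \<Longrightarrow> x $ i = 0" for x :: "(real^3)^'v"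
  proof -
    have "x = (\<Sum>i\<in>W. \<Sum>b\<in>Basis. (x $ i \<bullet> b) *\<^sub>R axis i b)"
    proof (subst vec_eq_iff, intro allI)
      fix j
      have "(\<Sum>i\<in>W. \<Sum>b\<in>Basis. (x $ i \<bullet> b) *\<^sub>R axis i b) $ j
          = (\<Sum>i\<in>W. \<Sum>b\<in>Basis. if i = j then (x $ i \<bullet> b) *\<^sub>R b else 0)"
        unfolding sum_component by (intro sum.cong) (auto simp: axis_def)
      also have "\<dots> = (\<Sum>i\<in>W. if i = j then x $ i else 0)"
        by (intro sum.cong) (auto simp: euclidean_representation)
      also have "\<dots> = x $ j" using x[of j] by simp
      finally show "x $ j = (\<Sum>i\<in>W. \<Sum>b\<in>Basis. (x $ i \<bullet> b) *\<^sub>R axis i b) $ j" ..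
    qed
    also have "\<dots> \<in> span B"
      by (intro span_sum span_scale span_base) (auto simp: B_def)
    finally show ?thesis .
  qed
  have "?R \<union> ?K \<subseteq> span B"
  proof
    fix x assume "x \<in> ?R \<union> ?K"
    then have "x $ i = 0" if "i \<notin> W" for i
      using F(1) that by (fastforce simp: edge_row_def killing_motion_def axis_def)
    then show "x \<in> span B" by (rule supp)
  qed
  then have "dim (?R \<union> ?K) \<le> card B"
    using dim_le_card[OF _ \<open>finite B\<close>] by blast
  moreover have "dim (?R \<union> ?K) = dim ?R + dim ?K"
  proof (rule dim_orthogonal_sum)
    fix x y assume "x \<in> ?R" "y \<in> ?K"
    then show "x \<bullet> y = 0"
      using gradient_inner_killing[of _ _ F W q] F(1) by blast
  qed
  moreover have "dim ?R = card F + card W"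
    using indep_family_dim[OF ind] by (simp add: card_Plus)
  moreover have "3 \<le> dim ?K"
    using dim_killing_motions[OF nd ab(2,3)] .
  ultimately show ?thesis
    using \<open>card B \<le> 3 * card W\<close> by simp
qed

text \<open>For the full number of edges, the gradients and the infinitesimal isometries together span the
  whole velocity space, so nothing else is orthogonal to the gradients.\<close>

lemma motion_is_killing:
  fixes q :: "(real^3)^'v::finite"
  assumes ind: "indep_family (F <+> UNIV) (\<lambda>c. gradient c q)"
    and F: "\<And>e. e \<in> F \<Longrightarrow> card e = 2" "F \<noteq> {}"
    and n: "\<And>i. normal (q $ i) \<noteq> 0" and tight: "card F + 3 = 2 * CARD('v)"
    and u: "\<And>c. c \<in> F <+> UNIV \<Longrightarrow> gradient c q \<bullet> u = 0"
  shows "u \<in> killing_motion UNIV q ` killing_pairs"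
proof -
  obtain a b where ab: "{a, b} \<in> F" using F by (metis all_not_in_conv card_2_iff)
  have sub: "indep_family ({{a, b}} <+> UNIV) (\<lambda>c. gradient c q)"
    by (rule indep_family_mono[OF ind]) (use ab in auto)
  have nd: "nondegenerate (q $ a) (q $ b)"
    using nondegenerate_of_indep[OF sub] n by simp
  let ?R = "(\<lambda>c. gradient c q) ` (F <+> UNIV)" and ?K = "killing_motion UNIV q ` killing_pairs"
  have RK: "x \<bullet> y = 0" if "x \<in> ?R" "y \<in> ?K" for x y
    using that gradient_inner_killing[of _ _ F UNIV q] F(1) by auto
  have "dim (?R \<union> ?K) = dim ?R + dim ?K"
    by (rule dim_orthogonal_sum) (use RK in auto)
  moreover have "dim ?R = card F + CARD('v)"
    using indep_family_dim[OF ind] by (simp add: card_Plus)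
  moreover have "3 \<le> dim ?K"
    using dim_killing_motions[OF nd] by simp
  ultimately have "DIM((real^3)^'v) \<le> dim (?R \<union> ?K)"
    using tight by simp
  then have full: "span (?R \<union> ?K) = UNIV"
    using dim_eq_full[of "?R \<union> ?K"] dim_subset_UNIV[of "?R \<union> ?K"] by simp
  obtain y z where y: "y \<in> span ?K" and z: "\<And>w. w \<in> span ?K \<Longrightarrow> orthogonal z w" and uyz: "u = y + z"
    using orthogonal_subspace_decomp_exists[of ?K u] by metis
  have yK: "y \<in> ?K"
    using y span_eq_iff[of ?K] linear_subspace_image[OF linear_killing_motion subspace_killing_pairs]
    by metis
  have "orthogonal z w" if "w \<in> ?R \<union> ?K" for w
    using that
  proof
    assume w: "w \<in> ?R"
    then have "w \<bullet> u = 0" using u by auto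
    moreover have "w \<bullet> y = 0" using RK[OF w yK] .
    ultimately show ?thesis by (simp add: uyz inner_add_right orthogonal_def inner_commute)
  qed (use z span_base in blast)
  then have "orthogonal z z"
    using orthogonal_to_span[of z "?R \<union> ?K" z] full by blast
  then have "z = 0" by (simp add: orthogonal_def)
  with uyz yK show ?thesis by simp
qed

section \<open>Independent tight frameworks are rigid\<close>

lemma placements_iff:
  assumes "\<And>e. e \<in> F \<Longrightarrow> card e = 2"
  shows "q \<in> placements surface F p \<longleftrightarrow>
    (\<forall>i. q $ i \<in> surface) \<and> (\<forall>e\<in>F. constraint (Inl e) q = constraint (Inl e) p)"
  using assms by (auto simp: placements_def edge_sq_length_eq_energy)

text \<open>Since only finitely many levels occur, a vertex cannot change its plane or sphere in a small
  motion.\<close>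

lemma eventually_same_level:
  fixes p :: "(real^3)^'v::finite"
  shows "\<forall>\<^sub>F q in nhds p. \<forall>i. q $ i \<in> surface \<longrightarrow> potential (q $ i) = potential (p $ i)"
proof (rule eventually_all_finite)
  fix i :: 'v
  have op: "open (- (T - {potential (p $ i)}))"
    using finite_levels by (intro open_Compl finite_imp_closed) auto
  have cont: "continuous_on UNIV (\<lambda>q :: (real^3)^'v. potential (q $ i))"
    by (rule continuous_on_compose2[OF continuous_on_potential]) (auto intro: continuous_intros)
  have lim: "((\<lambda>q. potential (q $ i)) \<longlongrightarrow> potential (p $ i)) (nhds p)"
    using cont by (simp add: continuous_on_eq_continuous_at isCont_def tendsto_nhds_iff)
  have "\<forall>\<^sub>F q in nhds p. potential (q $ i) \<in> - (T - {potential (p $ i)})"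
    by (rule topological_tendstoD[OF lim op]) auto
  then show "\<forall>\<^sub>F q in nhds p. q $ i \<in> surface \<longrightarrow> potential (q $ i) = potential (p $ i)"
    by eventually_elim (auto simp: surface_def)
qed

lemma rigid_of_eventually_congruent:
  assumes "\<forall>\<^sub>F q in nhds p. q \<in> placements M F p \<longrightarrow> q \<in> placements M (complete_edges UNIV) p"
  shows "rigid M F p"
  unfolding rigid_def
proof (intro allI impI)
  fix \<gamma> assume g: "path \<gamma> \<and> path_image \<gamma> \<subseteq> placements M F p \<and> pathstart \<gamma> = p"
  obtain U where U: "open U" "p \<in> U"
    "\<And>q. q \<in> U \<Longrightarrow> q \<in> placements M F p \<Longrightarrow> q \<in> placements M (complete_edges UNIV) p"
    using assms unfolding eventually_nhds by blast
  have "continuous_on {0..1} \<gamma>" "\<gamma> 0 = p"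
    using g by (auto simp: path_def pathstart_def)
  then have "(\<gamma> \<longlongrightarrow> p) (at 0 within {0..1})"
    by (auto simp: continuous_on_def)
  then have "\<forall>\<^sub>F t in at 0 within {0..1}. \<gamma> t \<in> U"
    using U by (intro topological_tendstoD)
  then obtain \<delta> where \<delta>: "\<delta> > 0" "\<And>t. t \<in> {0..1} \<Longrightarrow> t \<noteq> 0 \<Longrightarrow> dist t 0 < \<delta> \<Longrightarrow> \<gamma> t \<in> U"
    unfolding eventually_at by auto
  show "\<exists>\<delta>\<in>{0<..1}. \<gamma> ` {0..<\<delta>} \<subseteq> placements M (complete_edges UNIV) p"
  proof (intro bexI[of _ "min \<delta> 1"] subsetI)
    fix q assume "q \<in> \<gamma> ` {0..<min \<delta> 1}"
    then obtain t where t: "q = \<gamma> t" "0 \<le> t" "t < \<delta>" "t < 1" by auto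
    have "\<gamma> t \<in> U"
      using \<delta>(2)[of t] t U(2) \<open>\<gamma> 0 = p\<close> by (cases "t = 0") auto
    moreover have "\<gamma> t \<in> placements M F p"
      using g t by (auto simp: path_image_def)
    ultimately show "q \<in> placements M (complete_edges UNIV) p"
      using U(3) t(1) by blast
  qed (use \<delta> in auto)
qed

text \<open>Let \<open>q\<close> be a placement near \<open>p\<close> with the same edge lengths. By the midpoint identity \<open>q - p\<close> is an
  infinitesimal motion of the midpoint placement \<open>m\<close>, where the gradients are still independent. It is
  thus an infinitesimal isometry at \<open>m\<close>, and by the midpoint identity again all distances in \<open>p\<close> and
  \<open>q\<close> agree.\<close>

lemma rigid_of_indep_tight:
  fixes p :: "(real^3)^'v::finite"
  assumes ind: "indep_family (F <+> UNIV) (\<lambda>c. gradient c p)"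
    and F: "\<And>e. e \<in> F \<Longrightarrow> card e = 2" "F \<noteq> {}" and tight: "card F + 3 = 2 * CARD('v)"
    and p: "\<And>i. p $ i \<in> surface"
  shows "rigid surface F p"
proof (rule rigid_of_eventually_congruent)
  have mid: "filterlim (\<lambda>q. (1/2) *\<^sub>R (p + q)) (nhds p) (nhds p)"
  proof -
    have "((\<lambda>q. (1/2) *\<^sub>R (p + q)) \<longlongrightarrow> (1/2) *\<^sub>R (p + p)) (nhds p)"
      by (intro tendsto_intros filterlim_ident)
    then show ?thesis by (simp add: scaleR_2[symmetric])
  qed
  show "\<forall>\<^sub>F q in nhds p. q \<in> placements surface F p \<longrightarrow> q \<in> placements surface (complete_edges UNIV) p"
    using eventually_same_level[of p] eventually_compose_filterlim[OF eventually_indep_gradients[OF ind] mid]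
  proof eventually_elim
    case (elim q)
    show ?case
    proof
      assume q: "q \<in> placements surface F p"
      define m where "m = (1/2) *\<^sub>R (p + q)"
      have im: "indep_family (F <+> UNIV) (\<lambda>c. gradient c m)"
        using elim(2) by (simp add: m_def)
      have n: "normal (m $ i) \<noteq> 0" for i
      proof
        assume "normal (m $ i) = 0"
        then have "(\<Sum>c\<in>{Inr i}. 1 *\<^sub>R gradient c m) = 0" by (simp add: axis_eq_0_iff)
        moreover have "indep_family {Inr i} (\<lambda>c. gradient c m)"
          by (rule indep_family_mono[OF im]) auto
        ultimately show False
          using indep_familyD[of "{Inr i}" "\<lambda>c. gradient c m" "\<lambda>c. 1" "Inr i"] by simp
      qed
      have "constraint c q = constraint c p" if "c \<in> F <+> UNIV" for c
        using that q elim(1) F(1) by (auto simp: placements_iff)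
      then have "gradient c m \<bullet> (q - p) = 0" if "c \<in> F <+> UNIV" for c
        using constraint_diff[of c q p] that by (simp add: m_def)
      then obtain k where k: "k \<in> killing_pairs" "q - p = killing_motion UNIV m k"
        using motion_is_killing[OF im F n tight] by blast
      have "constraint (Inl e) q = constraint (Inl e) p" if "card e = 2" for e
      proof -
        have "gradient (Inl e) m \<bullet> killing_motion UNIV m k = 0"
          by (rule gradient_inner_killing[OF k(1), of _ "{e}" UNIV]) (use that in auto)
        then show ?thesis
          using constraint_diff[of "Inl e" q p] k(2) by (simp add: m_def)
      qed
      then show "q \<in> placements surface (complete_edges UNIV) p"
        using q F(1) by (subst placements_iff) (auto simp: placements_iff complete_edges_def)
    qed
  qed
qed

end

section \<open>Flexing frameworks along curves\<close>

lemma right_derivative_const: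
  fixes f :: "real \<Rightarrow> 'a::real_normed_vector"
  assumes "(f has_vector_derivative D) (at 0)" "0 < \<delta>" "\<And>t. 0 \<le> t \<Longrightarrow> t < \<delta> \<Longrightarrow> f t = c"
  shows "D = 0"
proof (rule vector_derivative_unique_within)
  show "at 0 within {0..} \<noteq> (bot :: real filter)"
  proof -
    have "{0<..} \<subseteq> {0::real..}" by auto
    then show ?thesis
      using trivial_limit_at_right_real[of "0::real"] at_le[of "{0<..}" "{0..}" "0::real"]
      by (metis bot_unique)
  qed
  show "(f has_vector_derivative D) (at 0 within {0..})"
    using assms(1) has_vector_derivative_at_within by blast
  show "(f has_vector_derivative 0) (at 0 within {0..})"
    by (rule has_vector_derivative_transform_within[of "\<lambda>t. c" _ _ _ \<delta>])
      (use assms in \<open>auto simp: dist_real_def\<close>)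
qed

lemma right_derivative_inner_const:
  fixes f g :: "real \<Rightarrow> 'a::real_inner"
  assumes "(f has_vector_derivative f') (at 0)" "(g has_vector_derivative g') (at 0)" "0 < \<delta>"
    "\<And>t. 0 \<le> t \<Longrightarrow> t < \<delta> \<Longrightarrow> f t \<bullet> g t = c"
  shows "f 0 \<bullet> g' + f' \<bullet> g 0 = 0"
  by (rule right_derivative_const[OF
        bounded_bilinear.has_vector_derivative[OF bounded_bilinear_inner assms(1,2)] assms(3,4)])

lemma has_vector_derivative_vec_nth:
  "(f has_vector_derivative v) (at t) \<Longrightarrow> ((\<lambda>t. f t $ i) has_vector_derivative v $ i) (at t)"
  by (rule bounded_linear.has_vector_derivative[OF bounded_linear_vec_nth])

lemma rigid_along_curve:
  fixes \<gamma> :: "real \<Rightarrow> (real^3)^'v::finite"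
  assumes rig: "rigid M F p" and \<delta>: "0 < \<delta>" and g0: "\<gamma> 0 = p"
    and diff: "\<And>t. \<bar>t\<bar> < \<delta> \<Longrightarrow> \<gamma> differentiable (at t)"
    and pl: "\<And>t. 0 \<le> t \<Longrightarrow> t < \<delta> \<Longrightarrow> \<gamma> t \<in> placements M F p"
  obtains \<delta>' where "0 < \<delta>'" "\<delta>' \<le> \<delta>"
    "\<And>t. 0 \<le> t \<Longrightarrow> t < \<delta>' \<Longrightarrow> \<gamma> t \<in> placements M (complete_edges UNIV) p"
proof -
  let ?s = "\<lambda>t::real. t * (\<delta> / 2)"
  have small: "\<bar>?s t\<bar> < \<delta>" if "t \<in> {0..1}" for t
  proof -
    have "t * \<delta> \<le> 1 * \<delta>" using that \<delta> by (intro mult_right_mono) auto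
    then show ?thesis using that \<delta> by (simp add: abs_mult)
  qed
  have "path (\<gamma> \<circ> ?s)"
    unfolding path_def
  proof (rule continuous_on_compose)
    show "continuous_on (?s ` {0..1}) \<gamma>"
      using small diff differentiable_imp_continuous_within
      by (intro continuous_at_imp_continuous_on) blast
  qed (intro continuous_intros)
  moreover have "path_image (\<gamma> \<circ> ?s) \<subseteq> placements M F p"
    using small pl \<delta> by (auto simp: path_image_def)
  moreover have "pathstart (\<gamma> \<circ> ?s) = p"
    using g0 by (simp add: pathstart_def)
  ultimately obtain \<eta> where \<eta>: "\<eta> \<in> {0<..1}"
      "(\<gamma> \<circ> ?s) ` {0..<\<eta>} \<subseteq> placements M (complete_edges UNIV) p"
    using rig unfolding rigid_def by blast
  show ?thesis
  proof
    show "0 < \<eta> * (\<delta> / 2)" using \<eta> \<delta> by simp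
    have "\<eta> * \<delta> \<le> 1 * \<delta>" using \<eta> \<delta> by (intro mult_right_mono) auto
    then show "\<eta> * (\<delta> / 2) \<le> \<delta>" using \<delta> by simp
    show "\<gamma> t \<in> placements M (complete_edges UNIV) p" if "0 \<le> t" "t < \<eta> * (\<delta> / 2)" for t
    proof -
      have "t / (\<delta> / 2) \<in> {0..<\<eta>}"
        using that \<delta> by (simp add: field_simps)
      moreover have "\<gamma> t = (\<gamma> \<circ> ?s) (t / (\<delta> / 2))" using \<delta> by simp
      ultimately show ?thesis using \<eta>(2) by blast
    qed
  qed
qed

context surface_family
begin

lemma motion_curve:
  fixes p :: "(real^3)^'v::finite"
  assumes ind: "indep_family (F <+> UNIV) (\<lambda>c. gradient c p)"
    and F: "\<And>e. e \<in> F \<Longrightarrow> card e = 2" and p: "\<And>i. p $ i \<in> surface"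
    and u: "\<And>c. c \<in> F <+> UNIV \<Longrightarrow> gradient c p \<bullet> u = 0"
  obtains \<gamma> \<delta> where "0 < \<delta>" "\<gamma> 0 = p" "(\<gamma> has_vector_derivative u) (at 0)"
    "\<And>t. \<bar>t\<bar> < \<delta> \<Longrightarrow> \<gamma> differentiable (at t)"
    "\<And>t c. \<bar>t\<bar> < \<delta> \<Longrightarrow> c \<in> F <+> UNIV \<Longrightarrow> constraint c (\<gamma> t) = constraint c p"
    "\<And>t. \<bar>t\<bar> < \<delta> \<Longrightarrow> \<gamma> t \<in> placements surface F p"
proof -
  obtain \<gamma> \<delta> where g: "0 < \<delta>" "\<gamma> 0 = p" "(\<gamma> has_vector_derivative u) (at 0)"
    "\<And>t. \<bar>t\<bar> < \<delta> \<Longrightarrow> \<gamma> differentiable (at t)"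
    "\<And>t c. \<bar>t\<bar> < \<delta> \<Longrightarrow> c \<in> F <+> UNIV \<Longrightarrow> constraint c (\<gamma> t) = constraint c p"
    by (rule constraint_curve[OF _ has_derivative_constraint continuous_gradient ind u]) auto
  show ?thesis
  proof
    show "\<gamma> t \<in> placements surface F p" if "\<bar>t\<bar> < \<delta>" for t
    proof -
      have "potential (\<gamma> t $ i) = potential (p $ i)" for i
        using g(5)[OF that, of "Inr i"] by (simp add: InrI)
      then have "\<gamma> t $ i \<in> surface" for i
        using p[of i] by (simp add: surface_def)
      moreover have "constraint (Inl e) (\<gamma> t) = constraint (Inl e) p" if "e \<in> F" for e
        using g(5)[OF \<open>\<bar>t\<bar> < \<delta>\<close>, of "Inl e"] that by (simp add: InlI)
      ultimately show ?thesis
        using F by (simp add: placements_iff)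
    qed
  qed (use g in auto)
qed

lemma constraint_along_curve:
  assumes "(\<gamma> has_vector_derivative v) (at t)"
  shows "((\<lambda>t. constraint c (\<gamma> t)) has_vector_derivative gradient c (\<gamma> t) \<bullet> v) (at t)"
  using has_derivative_compose[OF assms[unfolded has_vector_derivative_def]
      has_derivative_constraint[of c]]
  by (simp add: has_vector_derivative_def)

text \<open>A vector dual to the gradient of \<open>e\<close> is an infinitesimal motion of the other edges that changes the
  length of \<open>e\<close> to first order, and it is the velocity of an actual motion.\<close>

lemma not_rigid_remove_edge:
  fixes p :: "(real^3)^'v::finite"
  assumes ind: "indep_family (E <+> UNIV) (\<lambda>c. gradient c p)" and e: "e \<in> E"
    and E: "\<And>e. e \<in> E \<Longrightarrow> card e = 2" and p: "\<And>i. p $ i \<in> surface"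
  shows "\<not> rigid surface (E - {e}) p"
proof
  assume rig: "rigid surface (E - {e}) p"
  have eE: "Inl e \<in> E <+> UNIV" using e by auto
  obtain u where u: "gradient (Inl e) p \<bullet> u = 1"
    "\<And>c. c \<in> E <+> UNIV \<Longrightarrow> c \<noteq> Inl e \<Longrightarrow> gradient c p \<bullet> u = 0"
    using indep_family_dual_vector[OF ind _ eE] by auto
  have ind': "indep_family ((E - {e}) <+> UNIV) (\<lambda>c. gradient c p)"
    by (rule indep_family_mono[OF ind]) auto
  have u': "gradient c p \<bullet> u = 0" if "c \<in> (E - {e}) <+> UNIV" for c
    using that u(2)[of c] by auto
  obtain \<gamma> \<delta> where g: "0 < \<delta>" "\<gamma> 0 = p" "(\<gamma> has_vector_derivative u) (at 0)"
    "\<And>t. \<bar>t\<bar> < \<delta> \<Longrightarrow> \<gamma> differentiable (at t)"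
    "\<And>t. \<bar>t\<bar> < \<delta> \<Longrightarrow> \<gamma> t \<in> placements surface (E - {e}) p"
    by (rule motion_curve[OF ind' _ p u']) (use E in auto)
  obtain \<delta>' where d: "0 < \<delta>'" "\<delta>' \<le> \<delta>"
    "\<And>t. 0 \<le> t \<Longrightarrow> t < \<delta>' \<Longrightarrow> \<gamma> t \<in> placements surface (complete_edges UNIV) p"
    by (rule rigid_along_curve[where \<gamma> = \<gamma>, OF rig g(1,2,4)]) (use g(5) in auto)
  have "constraint (Inl e) (\<gamma> t) = constraint (Inl e) p" if "0 \<le> t" "t < \<delta>'" for t
    using d(3)[OF that] E[OF e] by (subst (asm) placements_iff) (auto simp: complete_edges_def)
  from right_derivative_const[OF constraint_along_curve[OF g(3)] d(1) this]
  show False using u(1) g(2) by simp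
qed

text \<open>All inner products of the normal at \<open>q a\<close>, of \<open>q a - q b\<close> and of \<open>q k - q a\<close> are functions of the levels
  and of the distances, so they are constant along a congruence. If \<open>q k - q a\<close> is a combination of the
  first two vectors, it stays the same combination, and these two have velocity zero. Otherwise
  its velocity is orthogonal to both of them and to the component of \<open>q k - q a\<close> orthogonal to them, and
  these three vectors are independent.\<close>

lemma congruent_velocity_determined:
  fixes p :: "(real^3)^'v::finite"
  assumes g0: "\<gamma> 0 = p" and gd: "(\<gamma> has_vector_derivative u) (at 0)" and \<delta>: "0 < \<delta>"
    and level: "\<And>t i. 0 \<le> t \<Longrightarrow> t < \<delta> \<Longrightarrow> potential (\<gamma> t $ i) = potential (p $ i)"
    and congr: "\<And>t i j. 0 \<le> t \<Longrightarrow> t < \<delta> \<Longrightarrow> norm (\<gamma> t $ i - \<gamma> t $ j) = norm (p $ i - p $ j)"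
    and pin: "u $ a = 0" "u $ b = 0" and nd: "nondegenerate (p $ a) (p $ b)"
  shows "u = 0"
proof -
  have "u $ k = 0" for k
  proof -
    define x where "x t = normal (\<gamma> t $ a)" for t
    define y where "y t = \<gamma> t $ a - \<gamma> t $ b" for t
    define w where "w t = \<gamma> t $ k - \<gamma> t $ a" for t
    have sq: "(\<gamma> t $ i - \<gamma> t $ j) \<bullet> (\<gamma> t $ i - \<gamma> t $ j) = (p $ i - p $ j) \<bullet> (p $ i - p $ j)"
      if "0 \<le> t" "t < \<delta>" for t i j
      using congr[OF that] by (metis power2_norm_eq_inner)
    have nrm: "normal (\<gamma> t $ a) \<bullet> (\<gamma> t $ i - \<gamma> t $ a) = normal (p $ a) \<bullet> (p $ i - p $ a)"
      if "0 \<le> t" "t < \<delta>" for t i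
      unfolding normal_inner_diff using sq[OF that] level[OF that] by simp
    have xx: "x t \<bullet> x t = x 0 \<bullet> x 0" and xw: "x t \<bullet> w t = x 0 \<bullet> w 0"
      and yy: "y t \<bullet> y t = y 0 \<bullet> y 0" and ww: "w t \<bullet> w t = w 0 \<bullet> w 0"
      if "0 \<le> t" "t < \<delta>" for t
      using level[OF that] nrm[OF that] sq[OF that] normal_inner_normal
      by (simp_all add: x_def y_def w_def g0)
    have xy: "x t \<bullet> y t = x 0 \<bullet> y 0" if "0 \<le> t" "t < \<delta>" for t
      using nrm[OF that, of b] by (simp add: x_def y_def g0 inner_diff_right)
    have yw: "y t \<bullet> w t = y 0 \<bullet> w 0" if t: "0 \<le> t" "t < \<delta>" for t
    proof -
      have "2 * (y t \<bullet> w t) = (\<gamma> t $ k - \<gamma> t $ b) \<bullet> (\<gamma> t $ k - \<gamma> t $ b) - y t \<bullet> y t - w t \<bullet> w t" for t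
        by (simp add: y_def w_def algebra_simps inner_diff_left inner_diff_right inner_commute)
      from this[of t] this[of 0] show ?thesis
        using yy[OF t] ww[OF t] sq[OF t, of k b] by (simp add: g0)
    qed
    obtain v z0 where v: "v \<in> span {x 0, y 0}" and z0: "\<And>s. s \<in> span {x 0, y 0} \<Longrightarrow> orthogonal z0 s"
      and w0: "w 0 = v + z0"
      using orthogonal_subspace_decomp_exists[of "{x 0, y 0}" "w 0"] by metis
    obtain \<alpha> \<beta> where ab: "v = \<alpha> *\<^sub>R x 0 + \<beta> *\<^sub>R y 0"
      using v by (auto simp: span_insert span_singleton) (metis add.commute diff_add_cancel)
    define z where "z t = w t - \<alpha> *\<^sub>R x t - \<beta> *\<^sub>R y t" for t
    have z_0: "z 0 = z0" by (simp add: z_def w0 ab)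
    have z0x: "z0 \<bullet> x 0 = 0" and z0y: "z0 \<bullet> y 0 = 0"
      using z0 by (auto simp: orthogonal_def span_base)
    have zx: "z t \<bullet> x t = 0" and zy: "z t \<bullet> y t = 0" and zz: "z t \<bullet> z t = z0 \<bullet> z0"
      if t: "0 \<le> t" "t < \<delta>" for t
    proof -
      have "z t \<bullet> x t = z 0 \<bullet> x 0" "z t \<bullet> y t = z 0 \<bullet> y 0" "z t \<bullet> z t = z 0 \<bullet> z 0"
        using xx[OF t] xw[OF t] yy[OF t] ww[OF t] xy[OF t] yw[OF t]
        by (simp_all add: z_def inner_diff_left inner_diff_right inner_commute)
      then show "z t \<bullet> x t = 0" "z t \<bullet> y t = 0" "z t \<bullet> z t = z0 \<bullet> z0"
        using z0x z0y by (simp_all add: z_0)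
    qed
    have comp: "((\<lambda>t. \<gamma> t $ i) has_vector_derivative u $ i) (at 0)" for i
      by (rule has_vector_derivative_vec_nth[OF gd])
    have "(x has_vector_derivative \<epsilon> *\<^sub>R u $ a + 0) (at 0)"
      unfolding x_def[abs_def] normal_def
      by (intro has_vector_derivative_add has_vector_derivative_const
          bounded_linear.has_vector_derivative[OF bounded_linear_scaleR_right] comp)
    then have dx: "(x has_vector_derivative 0) (at 0)" using pin by simp
    have "(y has_vector_derivative u $ a - u $ b) (at 0)"
      unfolding y_def[abs_def] by (intro has_vector_derivative_diff comp)
    then have dy: "(y has_vector_derivative 0) (at 0)" using pin by simp
    have "(z has_vector_derivative (u $ k - u $ a) - \<alpha> *\<^sub>R 0 - \<beta> *\<^sub>R 0) (at 0)"
      unfolding z_def[abs_def] w_def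
      by (intro has_vector_derivative_diff comp
          bounded_linear.has_vector_derivative[OF bounded_linear_scaleR_right] dx dy)
    then have dz: "(z has_vector_derivative u $ k) (at 0)" using pin by simp
    show "u $ k = 0"
    proof (cases "z0 = 0")
      case True
      then have "z t = 0" if "0 \<le> t" "t < \<delta>" for t
        using zz[OF that] by simp
      from right_derivative_const[OF dz \<delta> this] show ?thesis .
    next
      case False
      have ux: "u $ k \<bullet> x 0 = 0"
        using right_derivative_inner_const[OF dz dx \<delta> zx] by simp
      have uy: "u $ k \<bullet> y 0 = 0"
        using right_derivative_inner_const[OF dz dy \<delta> zy] by simp
      have uz: "u $ k \<bullet> z0 = 0"
        using right_derivative_inner_const[OF dz dz \<delta> zz] by (simp add: z_0 inner_commute)
      let ?N = "x 0 \<times> y 0"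
      have N: "?N \<noteq> 0" using nd by (simp add: nondegenerate_def x_def y_def g0)
      have "?N \<times> u $ k = 0" "?N \<times> z0 = 0"
        using ux uy z0x z0y Lagrange[of "u $ k" "x 0" "y 0"] Lagrange[of z0 "x 0" "y 0"]
          cross_skew[of ?N "u $ k"] cross_skew[of ?N z0] by simp_all
      then obtain s s' where s: "u $ k = s *\<^sub>R ?N" "z0 = s' *\<^sub>R ?N"
        using parallel_of_cross_zero N by metis
      with uz N False show ?thesis by auto
    qed
  qed
  then show ?thesis by (simp add: vec_eq_iff)
qed

end

section \<open>Regularity in terms of gradients\<close>

lemma dim_range_inner:
  fixes r :: "'c::finite \<Rightarrow> 'a::euclidean_space"
  shows "dim (range (\<lambda>u. \<chi> c. r c \<bullet> u)) = dim (range r)"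
proof -
  define f where "f u = (\<chi> c. r c \<bullet> u)" for u
  have lin: "linear f"
    by (intro linearI) (simp_all add: f_def vec_eq_iff inner_add_right)
  have "range f = f ` span (range r)"
  proof (intro equalityI subsetI)
    fix x assume "x \<in> range f"
    then obtain u where u: "x = f u" by auto
    obtain y z where y: "y \<in> span (range r)" and z: "\<And>w. w \<in> span (range r) \<Longrightarrow> orthogonal z w"
      and uyz: "u = y + z"
      using orthogonal_subspace_decomp_exists[of "range r" u] by metis
    have "r c \<bullet> z = 0" for c
      using z[of "r c"] by (simp add: orthogonal_def span_base inner_commute)
    then have "f u = f y" by (simp add: f_def uyz inner_add_right)
    with u y show "x \<in> f ` span (range r)" by auto
  qed auto
  moreover have "inj_on f (span (range r))"
    unfolding linear_injective_on_subspace_0[OF lin subspace_span]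
  proof (intro ballI impI)
    fix x assume x: "x \<in> span (range r)" "f x = 0"
    then have "orthogonal x (r c)" for c
      by (simp add: f_def vec_eq_iff orthogonal_def inner_commute)
    then have "orthogonal x x"
      using orthogonal_to_span[OF x(1)] by blast
    then show "x = 0" by (simp add: orthogonal_def)
  qed
  then have "dim (f ` span (range r)) = dim (span (range r))"
    by (intro dim_image_eq[OF lin]) (simp only: span_span)
  ultimately show ?thesis
    by (simp add: f_def[abs_def])
qed

text \<open>Row rank equals column rank; the factor two between the gradient of a squared length and the
  edge row, and the vanishing components, do not affect the span.\<close>

lemma derivative_rank_augmented:
  fixes q :: "(real^3)^'v::finite" and D :: "'v \<Rightarrow> real^3"
  assumes F: "\<And>e. e \<in> F \<Longrightarrow> card e = 2" and D: "\<And>i. i \<in> W \<Longrightarrow> GDERIV (h i) (q $ i) :> D i"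
  shows "derivative_rank (augmented_edge_fun W F h) q = dim (edge_row q ` F \<union> (\<lambda>i. axis i (D i)) ` W)"
proof -
  define r where "r c = (case c of Inl e \<Rightarrow> if e \<in> F then 2 *\<^sub>R edge_row q e else 0
    | Inr i \<Rightarrow> if i \<in> W then axis i (D i) else 0)" for c
  have "(augmented_edge_fun W F h has_derivative (\<lambda>u. \<chi> c. r c \<bullet> u)) (at q)"
  proof (rule has_derivative_componentwise_within[THEN iffD2], rule ballI)
    fix b :: "real^('v set + 'v)" assume "b \<in> Basis"
    then obtain c where c: "b = axis c 1" by (auto simp: Basis_vec_def)
    have "((\<lambda>x. augmented_edge_fun W F h x $ c) has_derivative (\<lambda>u. r c \<bullet> u)) (at q)"
    proof (cases c)
      case (Inl e)
      have "((\<lambda>x. 2 * edge_energy e x) has_derivative (\<lambda>u. 2 * (edge_row q e \<bullet> u))) (at q)"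
        by (intro derivative_intros has_derivative_edge_energy)
      with Inl F show ?thesis
        by (cases "e \<in> F") (simp_all add: augmented_edge_fun_def r_def edge_sq_length_eq_energy)
    next
      case (Inr i)
      have "((\<lambda>x. h i (x $ i)) has_derivative (\<lambda>u. D i \<bullet> u $ i)) (at q)" if "i \<in> W"
        using has_derivative_compose[OF has_derivative_vec_nth D[OF that, unfolded gderiv_def]]
        by (simp only: inner_commute[of "D i"])
      with Inr show ?thesis
        by (cases "i \<in> W") (simp_all add: augmented_edge_fun_def r_def inner_axis')
    qed
    then show "((\<lambda>x. augmented_edge_fun W F h x \<bullet> b) has_derivative (\<lambda>u. (\<chi> c. r c \<bullet> u) \<bullet> b)) (at q)"
      by (simp add: c inner_axis)
  qed
  then have "derivative_rank (augmented_edge_fun W F h) q = dim (range r)"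
    using frechet_derivative_at dim_range_inner[of r] unfolding derivative_rank_def by metis
  also have "dim (range r) = dim (edge_row q ` F \<union> (\<lambda>i. axis i (D i)) ` W)" (is "_ = dim ?R")
  proof -
    have "r c \<in> span ?R" for c
    proof (cases c)
      case (Inl e)
      have "2 *\<^sub>R edge_row q e \<in> span ?R" if "e \<in> F"
        by (intro span_scale span_base) (use that in blast)
      with Inl show ?thesis by (simp add: r_def span_zero)
    next
      case (Inr i)
      have "axis i (D i) \<in> span ?R" if "i \<in> W"
        by (intro span_base) (use that in blast)
      with Inr show ?thesis by (simp add: r_def span_zero)
    qed
    then have "range r \<subseteq> span ?R" by blast
    moreover have "?R \<subseteq> span (range r)"
    proof
      fix x assume "x \<in> ?R"
      then consider e where "e \<in> F" "x = edge_row q e" | i where "i \<in> W" "x = axis i (D i)" by auto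
      then show "x \<in> span (range r)"
      proof cases
        case 1
        then have "x = (1/2) *\<^sub>R r (Inl e)" by (simp add: r_def)
        then show ?thesis by (simp only: span_scale span_base rangeI)
      next
        case 2
        then have "x = r (Inr i)" by (simp add: r_def)
        then show ?thesis by (simp only: span_base rangeI)
      qed
    qed
    ultimately have "span (range r) = span ?R"
      unfolding span_eq by blast
    then show ?thesis by (rule span_eq_dim)
  qed
  finally show ?thesis .
qed

context surface_family
begin

text \<open>A local equation vanishes along all curves in the surface. These attain every tangential
  velocity, so only the normal direction is left for the gradient.\<close>

lemma local_gradient_parallel:
  assumes U: "open U" "y \<in> U" "surface \<inter> U = {x \<in> U. g x = 0}" and y: "y \<in> surface"
    and g: "GDERIV g y :> D" "D \<noteq> 0"
  obtains s where "s \<noteq> 0" "D = s *\<^sub>R normal y"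
proof -
  have "D \<bullet> w = 0" if w: "normal y \<bullet> w = 0" for w
  proof -
    have "indep_family {()} (\<lambda>c. normal y)"
      using normal_nonzero[OF y] by (simp add: indep_family_def)
    then obtain \<gamma> \<delta> where c: "0 < \<delta>" "\<gamma> 0 = y" "(\<gamma> has_vector_derivative w) (at 0)"
        "\<And>t c. \<bar>t\<bar> < \<delta> \<Longrightarrow> c \<in> {()} \<Longrightarrow> potential (\<gamma> t) = potential y"
      by (rule constraint_curve[of "{()}" "\<lambda>c. potential" "\<lambda>c. normal" y w, rotated 3])
        (simp_all add: has_derivative_potential continuous_on_normal w)
    have "isCont \<gamma> 0"
      using c(3) has_vector_derivative_continuous by blast
    then have "(\<gamma> \<longlongrightarrow> y) (at 0)" using c(2) by (simp add: continuous_at)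
    from topological_tendstoD[OF this U(1,2)]
    obtain \<eta> where \<eta>: "\<eta> > 0" "\<And>t. t \<noteq> 0 \<Longrightarrow> dist t 0 < \<eta> \<Longrightarrow> \<gamma> t \<in> U"
      unfolding eventually_at by auto
    have zero: "(g \<circ> \<gamma>) t = 0" if "0 \<le> t" "t < min \<delta> \<eta>" for t
    proof -
      have "\<gamma> t \<in> surface"
        using c(4)[of t "()"] that y by (simp add: surface_def)
      moreover have "\<gamma> t \<in> U"
        using \<eta>(2)[of t] that c(2) U(2) by (cases "t = 0") auto
      ultimately show ?thesis using U(3) by auto
    qed
    have "(g has_derivative (\<lambda>h. h \<bullet> D)) (at (\<gamma> 0))"
      using g(1) c(2) by (simp add: gderiv_def)
    from has_derivative_compose[OF c(3)[unfolded has_vector_derivative_def] this]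
    have "((g \<circ> \<gamma>) has_vector_derivative w \<bullet> D) (at 0)"
      by (simp add: has_vector_derivative_def o_def)
    from right_derivative_const[OF this, of "min \<delta> \<eta>" 0] zero c(1) \<eta>(1) show ?thesis
      by (simp add: inner_commute)
  qed
  from parallel_of_perp_perp[OF normal_nonzero[OF y] this]
  have D: "D = ((D \<bullet> normal y) / (normal y \<bullet> normal y)) *\<^sub>R normal y" .
  show ?thesis
    by (rule that[OF _ D]) (use D g(2) in auto)
qed

text \<open>On the surface the rank does not depend on the choice of local equations. Away from it, where
  these may have arbitrary gradients, there remains the bound by the number of components.\<close>

lemma eventually_derivative_rank:
  fixes p :: "(real^3)^'v::finite"
  assumes loc: "\<And>i. local_equation surface (p $ i) (h i)" and F: "\<forall>e\<in>F. card e = 2"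
  shows "\<forall>\<^sub>F q in nhds p. derivative_rank (augmented_edge_fun W F h) q \<le> card F + card W \<and>
    ((\<forall>i. q $ i \<in> surface) \<longrightarrow>
      derivative_rank (augmented_edge_fun W F h) q = dim ((\<lambda>c. gradient c q) ` (F <+> W)))"
proof -
  have "\<forall>i. \<exists>V. open V \<and> p $ i \<in> V \<and> (\<forall>y\<in>V. \<exists>D. GDERIV (h i) y :> D \<and> D \<noteq> 0) \<and>
      surface \<inter> V = {y \<in> V. h i y = 0}"
    using loc unfolding local_equation_def by blast
  from choice[OF this] obtain U where
    U': "\<forall>i. open (U i) \<and> p $ i \<in> U i \<and> (\<forall>y\<in>U i. \<exists>D. GDERIV (h i) y :> D \<and> D \<noteq> 0) \<and>
      surface \<inter> U i = {y \<in> U i. h i y = 0}" ..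
  then have U: "\<And>i. open (U i)" "\<And>i. p $ i \<in> U i"
    "\<And>i y. y \<in> U i \<Longrightarrow> \<exists>D. GDERIV (h i) y :> D \<and> D \<noteq> 0" "\<And>i. surface \<inter> U i = {y \<in> U i. h i y = 0}"
    by auto
  have "\<forall>\<^sub>F q in nhds p. \<forall>i. q $ i \<in> U i"
  proof (rule eventually_all_finite)
    fix i
    have "((\<lambda>q. q $ i) \<longlongrightarrow> p $ i) (nhds p)"
      by (intro tendsto_vec_nth filterlim_ident)
    then show "\<forall>\<^sub>F q in nhds p. q $ i \<in> U i"
      using U(1,2) by (rule topological_tendstoD)
  qed
  then show ?thesis
  proof eventually_elim
    case (elim q)
    then have "\<forall>i. \<exists>D. GDERIV (h i) (q $ i) :> D \<and> D \<noteq> 0"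
      using U(3) by blast
    then obtain D where D: "\<And>i. GDERIV (h i) (q $ i) :> D i" "\<And>i. D i \<noteq> 0"
      by metis
    let ?R = "edge_row q ` F \<union> (\<lambda>i. axis i (D i)) ` W"
    have rank: "derivative_rank (augmented_edge_fun W F h) q = dim ?R"
      by (rule derivative_rank_augmented) (use F D in auto)
    have "dim ?R \<le> card ?R"
      by (rule dim_le_card') simp
    also have "\<dots> \<le> card F + card W"
      by (rule order_trans[OF card_Un_le add_mono]) (simp_all add: card_image_le)
    finally have "dim ?R \<le> card F + card W" .
    moreover have "dim ?R = dim ((\<lambda>c. gradient c q) ` (F <+> W))" if q: "\<forall>i. q $ i \<in> surface"
    proof -
      have "\<exists>s. s \<noteq> 0 \<and> D i = s *\<^sub>R normal (q $ i)" for i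
        using local_gradient_parallel[OF U(1) _ U(4) _ D(1) D(2), of i] q elim by metis
      then obtain s where s: "\<And>i. s i \<noteq> 0" "\<And>i. D i = s i *\<^sub>R normal (q $ i)"
        by metis
      let ?G = "(\<lambda>c. gradient c q) ` (F <+> W)"
      have ax: "axis i (D i) = s i *\<^sub>R gradient (Inr i) q" for i
        by (simp add: s(2) axis_def vec_eq_iff)
      have "?R \<subseteq> span ?G"
      proof
        fix x assume "x \<in> ?R"
        then consider e where "e \<in> F" "x = gradient (Inl e) q" |
          i where "i \<in> W" "x = s i *\<^sub>R gradient (Inr i) q" using ax by auto
        then show "x \<in> span ?G"
        proof cases
          case 1
          then have "x \<in> ?G" by blast
          then show ?thesis by (rule span_base)
        next
          case 2
          then have "gradient (Inr i) q \<in> ?G" by blast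
          then show ?thesis unfolding 2 by (intro span_scale span_base)
        qed
      qed
      moreover have "?G \<subseteq> span ?R"
      proof
        fix x assume "x \<in> ?G"
        then consider e where "e \<in> F" "x = edge_row q e" |
          i where "i \<in> W" "x = gradient (Inr i) q" by auto
        then show "x \<in> span ?R"
        proof cases
          case 2
          then have "x = inverse (s i) *\<^sub>R axis i (D i)" using s(1) by (simp add: ax del: normal_row.simps)
          moreover have "inverse (s i) *\<^sub>R axis i (D i) \<in> span ?R"
            by (intro span_scale span_base) (use 2 in blast)
          ultimately show ?thesis by simp
        qed (simp only: UnI1 imageI span_base)
      qed
      ultimately have "span ?R = span ?G" unfolding span_eq by (rule conjI)
      then show ?thesis by (rule span_eq_dim)
    qed
    ultimately show ?case using rank by simp
  qed
qed

text \<open>With independent gradients the rank already has the largest value that the number of components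
  allows.\<close>

lemma regular_of_indep:
  fixes p :: "(real^3)^'v::finite"
  assumes ind: "indep_family (F <+> W) (\<lambda>c. gradient c p)" and p: "\<And>i. p $ i \<in> surface"
    and loc: "\<And>i. local_equation surface (p $ i) (h i)" and F: "\<And>e. e \<in> F \<Longrightarrow> card e = 2"
  shows "regular h W F p"
proof -
  have "\<forall>e\<in>F. card e = 2" using F by blast
  note ev = eventually_derivative_rank[where h = h and W = W, OF loc this]
  have rank: "derivative_rank (augmented_edge_fun W F h) p = card F + card W"
    using eventually_nhds_x_imp_x[OF ev] p indep_family_dim[OF ind] by (simp add: card_Plus)
  show ?thesis
    unfolding regular_def using ev by eventually_elim (simp add: rank)
qed

lemma indep_normals:
  fixes p :: "(real^3)^'v::finite"
  assumes "\<And>i. normal (p $ i) \<noteq> 0"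
  shows "indep_family ({} <+> UNIV) (\<lambda>c. gradient c p)"
  unfolding indep_family_iff_tangential[where \<nu> = normal and q = p, OF assms]
  by (simp add: tangentially_independent_def)

text \<open>An edge whose length is critical on the surface has too small a rank, since moving one of its
  end points along the surface makes the length noncritical.\<close>

lemma nondegenerate_of_regular:
  fixes p :: "(real^3)^'v::finite"
  assumes reg: "regular h {a, b} {{a, b}} p" and ab: "a \<noteq> b" and p: "\<And>i. p $ i \<in> surface"
    and loc: "\<And>i. local_equation surface (p $ i) (h i)"
  shows "nondegenerate (p $ a) (p $ b)"
proof (rule ccontr)
  assume deg: "\<not> nondegenerate (p $ a) (p $ b)"
  let ?A = "augmented_edge_fun {a, b} {{a, b}} h"
  have n: "normal (p $ i) \<noteq> 0" for i using normal_nonzero p by simp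
  have F: "\<forall>e\<in>{{a, b}}. card e = 2" using ab by simp
  note ev = eventually_derivative_rank[where h = h and W = "{a, b}" and F = "{{a, b}}", OF loc F]
  let ?N = "{Inr a, Inr b} :: ('v set + 'v) set"
  have rank_p: "derivative_rank ?A p \<le> 2"
  proof -
    have "indep_family ?N (\<lambda>c. gradient c p)"
      by (rule indep_family_mono[OF indep_normals[OF n]]) auto
    moreover have eq: "insert (Inl {a, b}) ?N = {{a, b}} <+> {a, b}" by auto
    have "\<not> indep_family (insert (Inl {a, b}) ?N) (\<lambda>c. gradient c p)"
      using nondegenerate_of_indep[of a b "{a, b}" p] n deg unfolding eq by auto
    ultimately have "gradient (Inl {a, b}) p \<in> span ((\<lambda>c. gradient c p) ` ?N)"
      using in_span_of_not_indep_insert by (metis (no_types, lifting) finite.emptyI finite.insertI)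
    then have "dim (insert (gradient (Inl {a, b}) p) ((\<lambda>c. gradient c p) ` ?N)) = dim ((\<lambda>c. gradient c p) ` ?N)"
      by (metis dim_span span_redundant)
    also have "\<dots> \<le> card ((\<lambda>c. gradient c p) ` ?N)"
      by (rule dim_le_card') simp
    also have "\<dots> \<le> 2"
      using card_image_le[of ?N "\<lambda>c. gradient c p"] ab by simp
    finally have "dim ((\<lambda>c. gradient c p) ` ({{a, b}} <+> {a, b})) \<le> 2"
      by (simp only: eq[symmetric] image_insert)
    then show ?thesis
      using eventually_nhds_x_imp_x[OF ev] p by simp
  qed
  obtain z where z: "z \<noteq> 0" "orthogonal (normal (p $ a)) z"
    using orthogonal_to_vector_exists[of "normal (p $ a)"] by (auto simp: orthogonal_commute)
  have nz: "normal (p $ a) \<bullet> z = 0" using z(2) by (simp add: orthogonal_def)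
  have u: "gradient c p \<bullet> axis a z = 0" if "c \<in> {} <+> UNIV" for c
    using that nz by (auto simp: inner_axis') (simp add: axis_def)
  obtain \<gamma> \<delta> where g: "0 < \<delta>" "\<gamma> 0 = p" "(\<gamma> has_vector_derivative axis a z) (at 0)"
    "\<And>t. \<bar>t\<bar> < \<delta> \<Longrightarrow> \<gamma> t \<in> placements surface {} p"
    by (rule motion_curve[OF indep_normals[OF n] _ p u]) auto
  \<comment> \<open>Only \<open>a\<close> moves, so that degeneracy can be compared at the fixed end point \<open>b\<close>.\<close>
  define q where "q t = (\<chi> i. if i = a then \<gamma> t $ a else p $ i)" for t
  have q: "q t $ a = \<gamma> t $ a" "q t $ b = p $ b" for t
    using ab by (auto simp: q_def)
  have q_surf: "q t $ i \<in> surface" if "\<bar>t\<bar> < \<delta>" for t i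
    using g(4)[OF that] p by (auto simp: q_def placements_def)
  have da: "((\<lambda>t. \<gamma> t $ a) has_vector_derivative z) (at 0)"
    using has_vector_derivative_vec_nth[OF g(3), of a] by (simp add: axis_def)
  have "((\<lambda>t. \<gamma> t $ a) \<longlongrightarrow> p $ a) (at 0)"
    using has_vector_derivative_continuous[OF da] g(2) by (simp add: continuous_at)
  then have "((\<lambda>t. \<chi> i. if i = a then \<gamma> t $ a else p $ i) \<longlongrightarrow> (\<chi> i. if i = a then p $ a else p $ i)) (at 0)"
    by (intro tendsto_vec_lambda) auto
  moreover have "(\<chi> i. if i = a then p $ a else p $ i) = p" by (simp add: vec_eq_iff)
  ultimately have lim: "(q \<longlongrightarrow> p) (at 0)" by (simp add: q_def[abs_def])
  have "((\<lambda>t. (\<gamma> t $ a - p $ a) \<bullet> z) has_vector_derivative (z - 0) \<bullet> z) (at 0)"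
    by (intro bounded_linear.has_vector_derivative[OF bounded_linear_inner_left]
        has_vector_derivative_diff has_vector_derivative_const da)
  then have "((\<lambda>t. (\<gamma> t $ a - p $ a) \<bullet> z) has_real_derivative z \<bullet> z) (at 0)"
    by (simp add: has_real_derivative_iff_has_vector_derivative)
  from DERIV_pos_inc_right[OF this] z(1) g(2)
  obtain \<eta> where \<eta>: "\<eta> > 0" "\<And>t. 0 < t \<Longrightarrow> t < \<eta> \<Longrightarrow> (\<gamma> t $ a - p $ a) \<bullet> z > 0"
    by auto
  have "\<forall>\<^sub>F t in at 0. derivative_rank ?A (q t) \<le> derivative_rank ?A p \<and>
      ((\<forall>i. q t $ i \<in> surface) \<longrightarrow>
        derivative_rank ?A (q t) = dim ((\<lambda>c. gradient c (q t)) ` ({{a, b}} <+> {a, b})))"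
    using eventually_compose_filterlim[OF eventually_conj[OF reg[unfolded regular_def] ev] lim]
    by eventually_elim simp
  then obtain \<theta> where \<theta>: "\<theta> > 0" "\<And>t. t \<noteq> 0 \<Longrightarrow> dist t 0 < \<theta> \<Longrightarrow>
      derivative_rank ?A (q t) \<le> derivative_rank ?A p \<and> ((\<forall>i. q t $ i \<in> surface) \<longrightarrow>
        derivative_rank ?A (q t) = dim ((\<lambda>c. gradient c (q t)) ` ({{a, b}} <+> {a, b})))"
    unfolding eventually_at by auto
  define t where "t = min \<delta> (min \<eta> \<theta>) / 2"
  have t: "0 < t" "t < \<delta>" "t < \<eta>" "t < \<theta>"
    using g(1) \<eta>(1) \<theta>(1) by (auto simp: t_def)
  have qs: "q t $ i \<in> surface" for i using q_surf t by simp
  have "nondegenerate (q t $ a) (q t $ b)"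
  proof (rule ccontr)
    assume "\<not> nondegenerate (q t $ a) (q t $ b)"
    then have "\<not> nondegenerate (p $ b) (\<gamma> t $ a)" by (simp add: q nondegenerate_commute)
    then obtain s where s: "p $ b - \<gamma> t $ a = s *\<^sub>R normal (p $ b)"
      using parallel_of_cross_zero n unfolding nondegenerate_def by metis
    from deg have "\<not> nondegenerate (p $ b) (p $ a)" by (simp add: nondegenerate_commute)
    then obtain s' where s': "p $ b - p $ a = s' *\<^sub>R normal (p $ b)"
      using parallel_of_cross_zero n unfolding nondegenerate_def by metis
    from deg obtain s'' where s'': "p $ a - p $ b = s'' *\<^sub>R normal (p $ a)"
      using parallel_of_cross_zero n unfolding nondegenerate_def by metis
    have "normal (p $ b) = normal (p $ a) - \<epsilon> *\<^sub>R (p $ a - p $ b)"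
      by (simp flip: normal_diff)
    then have "normal (p $ b) \<bullet> z = 0"
      using nz by (simp add: s'' inner_diff_left)
    moreover have "\<gamma> t $ a - p $ a = (s' - s) *\<^sub>R normal (p $ b)"
      using s s' by (simp add: algebra_simps)
    ultimately have "(\<gamma> t $ a - p $ a) \<bullet> z = 0" by simp
    with \<eta>(2)[of t] t show False by simp
  qed
  from indep_of_nondegenerate[OF this] normal_nonzero[OF qs]
  have "indep_family ({{a, b}} <+> UNIV) (\<lambda>c. gradient c (q t))" by blast
  then have "indep_family ({{a, b}} <+> {a, b}) (\<lambda>c. gradient c (q t))"
    by (rule indep_family_mono) auto
  from indep_family_dim[OF this] have "dim ((\<lambda>c. gradient c (q t)) ` ({{a, b}} <+> {a, b})) = 3"
    using ab by (simp add: card_Plus)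
  with \<theta>(2)[of t] t qs rank_p show False by simp
qed

text \<open>If the edge gradients had too small a rank, there would be a nontrivial infinitesimal
  motion \<open>u\<close> fixing the end points \<open>a\<close> and \<open>b\<close> of an edge. A maximal independent set \<open>F\<close> of edges
  admits a curve with velocity \<open>u\<close>. By regularity the gradients of the other edges stay in
  the span of those of \<open>F\<close> at all nearby points of the surface, so the curve preserves all edge
  lengths, and rigidity makes it a congruence. Then its velocity \<open>u\<close> is zero.\<close>

lemma tight_basis_of_rigid:
  fixes p :: "(real^3)^'v::finite"
  assumes rig: "rigid surface E p" and reg: "regular h UNIV E p"
    and e: "{a, b} \<in> E" and nd: "nondegenerate (p $ a) (p $ b)"
    and E: "\<And>e. e \<in> E \<Longrightarrow> card e = 2" and p: "\<And>i. p $ i \<in> surface"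
    and loc: "\<And>i. local_equation surface (p $ i) (h i)"
  obtains F where "F \<subseteq> E" "indep_family (F <+> UNIV) (\<lambda>c. gradient c p)" "F \<noteq> {}"
    "card F + 3 = 2 * CARD('v)"
proof -
  have ab: "a \<noteq> b" using nd by (auto simp: nondegenerate_def)
  have n: "normal (p $ i) \<noteq> 0" for i using normal_nonzero p by simp
  let ?\<F> = "{F. F \<subseteq> E \<and> {a, b} \<in> F \<and> indep_family (F <+> UNIV) (\<lambda>c. gradient c p)}"
  have "{{a, b}} \<in> ?\<F>" using indep_of_nondegenerate[OF nd n] e by simp
  then have "?\<F> \<noteq> {}" by blast
  from finite_has_maximal[OF _ this] obtain F where F: "F \<in> ?\<F>" and
    max: "\<And>G. G \<in> ?\<F> \<Longrightarrow> F \<subseteq> G \<Longrightarrow> F = G" by auto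
  have ind: "indep_family (F <+> UNIV) (\<lambda>c. gradient c p)" and FE: "F \<subseteq> E" and abF: "{a, b} \<in> F"
    using F by auto
  have F2: "card e = 2" if "e \<in> F" for e using that FE E by auto
  have E': "\<forall>e\<in>E. card e = 2" using E by blast
  have F0: "F \<noteq> {}" using abF by auto
  have le: "card F + 3 \<le> 2 * CARD('v)"
    using indep_gradients_count[OF ind] F2 F0 n by simp
  let ?G = "\<lambda>q. (\<lambda>c. gradient c q) ` (F <+> UNIV)"
  let ?H = "\<lambda>q. (\<lambda>c. gradient c q) ` (E <+> UNIV)"
  have span_p: "gradient (Inl e) p \<in> span (?G p)" if "e \<in> E" for e
  proof (cases "e \<in> F")
    case True
    then show ?thesis by (intro span_base imageI InlI)
  next
    case False
    then have "insert e F \<notin> ?\<F>" using max[of "insert e F"] by blast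
    then have "\<not> indep_family (insert e F <+> UNIV) (\<lambda>c. gradient c p)"
      using FE abF that by auto
    moreover have "insert e F <+> (UNIV :: 'v set) = insert (Inl e) (F <+> UNIV)" by auto
    ultimately show ?thesis
      by (intro in_span_of_not_indep_insert[OF ind]) auto
  qed
  have dimG: "dim (?G q) = card F + CARD('v)" if "indep_family (F <+> UNIV) (\<lambda>c. gradient c q)" for q
    using indep_family_dim[OF that] by (simp add: card_Plus)
  have dimH: "dim (?H p) = card F + CARD('v)"
  proof -
    have "?H p \<subseteq> span (?G p)"
    proof
      fix x assume "x \<in> ?H p"
      then consider e where "e \<in> E" "x = gradient (Inl e) p" | i where "x = gradient (Inr i) p" by auto
      then show "x \<in> span (?G p)"
      proof cases
        case 2
        then have "x \<in> ?G p" by blast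
        then show ?thesis by (rule span_base)
      qed (simp only: span_p)
    qed
    moreover have "?G p \<subseteq> ?H p" using FE by (intro image_mono) auto
    ultimately show ?thesis
      using dimG[OF ind] dim_subset[of "?G p" "?H p"] dim_subset[of "?H p" "span (?G p)"] by simp
  qed
  have near: "\<forall>\<^sub>F q in nhds p. (\<forall>i. q $ i \<in> surface) \<longrightarrow> (\<forall>e\<in>E. gradient (Inl e) q \<in> span (?G q))"
    using reg[unfolded regular_def] eventually_indep_gradients[OF ind]
      eventually_derivative_rank[where h = h and W = UNIV and F = E, OF loc E']
  proof eventually_elim
    case (elim q)
    show ?case
    proof (intro impI ballI)
      fix e assume q: "\<forall>i. q $ i \<in> surface" and eE: "e \<in> E"
      have "derivative_rank (augmented_edge_fun UNIV E h) p = dim (?H p)"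
        using eventually_nhds_x_imp_x[OF
          eventually_derivative_rank[where h = h and W = UNIV and F = E, OF loc E']] p by simp
      then have "dim (?H q) \<le> dim (?G q)"
        using elim q dimG[OF elim(2)] dimH by simp
      moreover have "?G q \<subseteq> ?H q" using FE by (intro image_mono) auto
      ultimately have "span (?G q) = span (?H q)"
        by (metis dim_eq_span)
      moreover have "gradient (Inl e) q \<in> span (?H q)"
        by (intro span_base imageI InlI eE)
      ultimately show "gradient (Inl e) q \<in> span (?G q)" by simp
    qed
  qed
  have "\<not> card F + 3 < 2 * CARD('v)"
  proof
    assume less: "card F + 3 < 2 * CARD('v)"
    define C :: "('v set + 'v) set" where "C = (F - {{a, b}}) <+> (UNIV - {a, b})"
    \<comment> \<open>Holding \<open>a\<close> and \<open>b\<close> costs six conditions, but makes their edge and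
      their two normals superfluous.\<close>
    let ?B = "(\<lambda>c. gradient c p) ` C \<union> (axis a ` Basis \<union> axis b ` Basis)"
    have c3: "card (axis i ` (Basis :: (real^3) set) :: ((real^3)^'v) set) \<le> 3" for i :: 'v
      using card_image_le[of "Basis :: (real^3) set" "axis i :: _ \<Rightarrow> (real^3)^'v"] by simp
    have "card (axis a ` (Basis :: (real^3) set) \<union> axis b ` (Basis :: (real^3) set) :: ((real^3)^'v) set) \<le> 6"
      using card_Un_le[of "axis a ` (Basis :: (real^3) set) :: ((real^3)^'v) set" "axis b ` Basis"]
        c3[of a] c3[of b] by linarith
    moreover have "card ((\<lambda>c. gradient c p) ` C) \<le> card C"
      by (rule card_image_le) (simp add: C_def)
    moreover have "card C = (card F - 1) + (CARD('v) - 2)"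
      unfolding C_def using abF ab by (simp add: card_Plus card_Diff_subset)
    moreover have "card ?B \<le> card ((\<lambda>c. gradient c p) ` C) + card (axis a ` (Basis :: (real^3) set) \<union> axis b ` (Basis :: (real^3) set) :: ((real^3)^'v) set)"
      by (rule card_Un_le)
    moreover have "card F > 0" using F0 by (simp add: card_gt_0_iff)
    moreover have "CARD('v) \<ge> 2"
      using card_mono[of "UNIV :: 'v set" "{a, b}"] ab by simp
    ultimately have "card ?B < 3 * CARD('v)" using less by linarith
    moreover have "dim ?B \<le> card ?B"
      by (rule dim_le_card') (simp add: C_def)
    ultimately have "dim ?B < DIM((real^3)^'v)" by simp
    then obtain u where u0: "u \<noteq> 0" and u: "\<And>y. y \<in> span ?B \<Longrightarrow> orthogonal u y"
      using orthogonal_to_subspace_exists by blast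
    have uB: "y \<bullet> u = 0" if "y \<in> ?B" for y
      using u[OF span_base[OF that]] by (simp add: orthogonal_def inner_commute)
    have "x \<bullet> u $ a = 0" "x \<bullet> u $ b = 0" if "x \<in> Basis" for x
      using uB[of "axis a x"] uB[of "axis b x"] that by (simp_all add: inner_axis')
    then have ua: "u $ a = 0" and ub: "u $ b = 0"
      by (metis euclidean_all_zero_iff inner_commute)+
    have ug: "gradient c p \<bullet> u = 0" if "c \<in> F <+> UNIV" for c
    proof (cases "c \<in> C")
      case True
      then show ?thesis using uB by blast
    next
      case False
      with that have "c = Inl {a, b} \<or> c = Inr a \<or> c = Inr b" by (auto simp: C_def)
      then show ?thesis using ua ub by (auto simp: inner_edge_row_doubleton inner_axis')
    qed
    obtain \<gamma> \<delta> where g: "0 < \<delta>" "\<gamma> 0 = p" "(\<gamma> has_vector_derivative u) (at 0)"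
      "\<And>t. \<bar>t\<bar> < \<delta> \<Longrightarrow> \<gamma> differentiable (at t)"
      "\<And>t c. \<bar>t\<bar> < \<delta> \<Longrightarrow> c \<in> F <+> UNIV \<Longrightarrow> constraint c (\<gamma> t) = constraint c p"
      "\<And>t. \<bar>t\<bar> < \<delta> \<Longrightarrow> \<gamma> t \<in> placements surface F p"
      by (rule motion_curve[OF ind F2 p ug]) blast+
    have surf: "\<gamma> t $ i \<in> surface" if "\<bar>t\<bar> < \<delta>" for t i
      using g(6)[OF that] by (simp add: placements_def)
    have "isCont \<gamma> 0" using g(3) has_vector_derivative_continuous by blast
    then have "(\<gamma> \<longlongrightarrow> p) (at 0)" using g(2) by (simp add: continuous_at)
    from eventually_compose_filterlim[OF near this]
    obtain \<eta> where \<eta>: "\<eta> > 0" "\<And>t. t \<noteq> 0 \<Longrightarrow> dist t 0 < \<eta> \<Longrightarrow> (\<forall>i. \<gamma> t $ i \<in> surface) \<longrightarrow>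
        (\<forall>e\<in>E. gradient (Inl e) (\<gamma> t) \<in> span (?G (\<gamma> t)))"
      unfolding eventually_at by auto
    define \<theta> where "\<theta> = min \<delta> \<eta>"
    have \<theta>: "\<theta> > 0" "\<theta> \<le> \<delta>" "\<theta> \<le> \<eta>" using g(1) \<eta>(1) by (auto simp: \<theta>_def)
    have const: "constraint (Inl e) (\<gamma> t) = constraint (Inl e) p" if eE: "e \<in> E" and t: "\<bar>t\<bar> < \<theta>" for e t
    proof -
      have der: "((\<lambda>t. constraint (Inl e) (\<gamma> t)) has_derivative (\<lambda>h. 0)) (at t within {-\<theta><..<\<theta>})"
        if "t \<in> {-\<theta><..<\<theta>}" for t
      proof -
        have t: "\<bar>t\<bar> < \<theta>" "\<bar>t\<bar> < \<delta>" using that \<theta> by auto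
        obtain v where v: "(\<gamma> has_vector_derivative v) (at t)"
          using g(4)[OF t(2)] vector_derivative_works by blast
        have "gradient c (\<gamma> t) \<bullet> v = 0" if c: "c \<in> F <+> UNIV" for c
        proof -
          have "((\<lambda>t. constraint c (\<gamma> t)) has_vector_derivative 0) (at t)"
            by (rule has_vector_derivative_transform_within_open[of "\<lambda>t. constraint c p" _ _ "{-\<delta><..<\<delta>}"])
              (use g(5)[OF _ c] t in auto)
          from vector_derivative_unique_at[OF constraint_along_curve[OF v] this] show ?thesis .
        qed
        then have "orthogonal v y" if "y \<in> ?G (\<gamma> t)" for y
          using that by (auto simp: orthogonal_def inner_commute)
        moreover have "gradient (Inl e) (\<gamma> t) \<in> span (?G (\<gamma> t))"
        proof (cases "t = 0")
          case True
          then show ?thesis using span_p[OF eE] g(2) by simp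
        next
          case False
          then show ?thesis using \<eta>(2)[OF False] t \<theta> surf eE by (auto simp: dist_real_def)
        qed
        ultimately have "gradient (Inl e) (\<gamma> t) \<bullet> v = 0"
          using orthogonal_to_span[of "gradient (Inl e) (\<gamma> t)" "?G (\<gamma> t)" v]
          by (metis inner_commute orthogonal_def)
        with constraint_along_curve[OF v, of "Inl e"]
        have "((\<lambda>t. constraint (Inl e) (\<gamma> t)) has_vector_derivative 0) (at t)" by simp
        then show ?thesis
          by (simp add: has_vector_derivative_def has_derivative_at_withinI)
      qed
      obtain k where "\<And>t. t \<in> {-\<theta><..<\<theta>} \<Longrightarrow> constraint (Inl e) (\<gamma> t) = k"
        using has_derivative_zero_constant[OF _ der] convex_real_interval(8) by blast
      from this[of t] this[of 0] show ?thesis using t \<theta>(1) g(2) by (auto simp: abs_less_iff)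
    qed
    have pl: "\<gamma> t \<in> placements surface E p" if "0 \<le> t" "t < \<theta>" for t
      using const surf that \<theta> E by (subst placements_iff) auto
    have dif: "\<gamma> differentiable (at t)" if "\<bar>t\<bar> < \<theta>" for t using g(4) that \<theta> by auto
    obtain \<delta>' where d: "0 < \<delta>'" "\<delta>' \<le> \<theta>"
      "\<And>t. 0 \<le> t \<Longrightarrow> t < \<delta>' \<Longrightarrow> \<gamma> t \<in> placements surface (complete_edges UNIV) p"
      by (rule rigid_along_curve[where \<gamma> = \<gamma>, OF rig \<theta>(1) g(2) dif pl]) blast+
    have "u = 0"
    proof (rule congruent_velocity_determined[OF g(2,3) d(1) _ _ ua ub nd])
      fix t i assume "0 \<le> t" "t < \<delta>'"
      then show "potential (\<gamma> t $ i) = potential (p $ i)"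
        using g(5)[of t "Inr i"] d(2) \<theta> by (simp add: InrI)
    next
      fix t i j assume t: "0 \<le> t" "t < \<delta>'"
      show "norm (\<gamma> t $ i - \<gamma> t $ j) = norm (p $ i - p $ j)"
      proof (cases "i = j")
        case False
        then have "edge_sq_length (\<gamma> t) {i, j} = edge_sq_length p {i, j}"
          using d(3)[OF t] by (auto simp: placements_def complete_edges_def)
        then show ?thesis by (simp add: edge_sq_length_doubleton)
      qed simp
    qed
    with u0 show False by simp
  qed
  with le have "card F + 3 = 2 * CARD('v)" by simp
  then show ?thesis using that[OF FE ind F0] by blast
qed

end

section \<open>Sparse edge sets\<close>

text \<open>The Laman condition on the vertex subsets of \<open>W\<close>. A set for which equality holds is called tight
  in the sequel.\<close>

definition sparse_on :: "'v set \<Rightarrow> 'v set set \<Rightarrow> bool" where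
  "sparse_on W F \<longleftrightarrow> (\<forall>X\<subseteq>W. 2 \<le> card X \<longrightarrow> card {e\<in>F. e \<subseteq> X} + 3 \<le> 2 * card X)"

lemma sparse_onD: "sparse_on W F \<Longrightarrow> X \<subseteq> W \<Longrightarrow> 2 \<le> card X \<Longrightarrow> card {e\<in>F. e \<subseteq> X} + 3 \<le> 2 * card X"
  by (simp add: sparse_on_def)

lemma sum_degrees:
  assumes "finite W" "finite F" "\<And>e. e \<in> F \<Longrightarrow> e \<subseteq> W \<and> card e = 2"
  shows "(\<Sum>v\<in>W. card {e\<in>F. v \<in> e}) = 2 * card F"
proof -
  have "(\<Sum>v\<in>W. card {e\<in>F. v \<in> e}) = (\<Sum>v\<in>W. \<Sum>e\<in>F. of_bool (v \<in> e))"
    using assms by (intro sum.cong) (simp_all add: sum_of_bool_eq Int_def)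
  also have "\<dots> = (\<Sum>e\<in>F. \<Sum>v\<in>W. of_bool (v \<in> e))"
    by (rule sum.swap)
  also have "\<dots> = (\<Sum>e\<in>F. 2)"
  proof (intro sum.cong refl)
    fix e assume "e \<in> F"
    then have "W \<inter> e = e" "card e = 2" using assms(3) by auto
    then show "(\<Sum>v\<in>W. of_bool (v \<in> e)) = (2 :: nat)"
      using assms(1) by (simp add: sum_of_bool_eq Int_def[symmetric])
  qed
  finally show ?thesis by simp
qed

text \<open>The number of edges inside a vertex set is supermodular.\<close>

lemma union_tight:
  assumes sp: "sparse_on W F" and fin: "finite W" "finite F" and XY: "X \<subseteq> W" "Y \<subseteq> W"
    and t: "2 * card X \<le> card {e\<in>F. e \<subseteq> X} + 3" "2 * card Y \<le> card {e\<in>F. e \<subseteq> Y} + 3"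
    and I: "2 \<le> card (X \<inter> Y)"
  shows "2 * card (X \<union> Y) \<le> card {e\<in>F. e \<subseteq> X \<union> Y} + 3"
proof -
  let ?i = "\<lambda>X. {e\<in>F. e \<subseteq> X}"
  have "finite X" "finite Y" using XY fin finite_subset by blast+
  then have "card X + card Y = card (X \<union> Y) + card (X \<inter> Y)"
    by (rule card_Un_Int)
  moreover have "card (?i X) + card (?i Y) = card (?i X \<union> ?i Y) + card (?i X \<inter> ?i Y)"
    using fin by (intro card_Un_Int) auto
  moreover have "card (?i X \<union> ?i Y) \<le> card (?i (X \<union> Y))"
    using fin by (intro card_mono) auto
  moreover have "?i X \<inter> ?i Y = ?i (X \<inter> Y)" by auto
  moreover have "card (?i (X \<inter> Y)) + 3 \<le> 2 * card (X \<inter> Y)"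
    using sparse_onD[OF sp _ I] XY by auto
  ultimately show ?thesis using t by simp
qed

text \<open>When a vertex with the neighbours \<open>b, c, d\<close> is removed, it must be possible to join some pair of
  them. Otherwise each pair lies in a tight set. If two of these sets share at least two vertices,
  their union is tight; if they pairwise share one vertex each, the union of all three is tight.
  Together with the removed vertex, this union contains too many edges.\<close>

lemma no_three_tight_sets:
  assumes sp: "sparse_on W F" and fin: "finite W" "finite F"
    and F2: "\<And>e. e \<in> F \<Longrightarrow> card e = 2"
    and noU: "\<And>U. U \<subseteq> W \<Longrightarrow> b \<in> U \<Longrightarrow> c \<in> U \<Longrightarrow> d \<in> U \<Longrightarrow> card {e\<in>F. e \<subseteq> U} + 3 < 2 * card U"
    and X: "X \<subseteq> W" "b \<in> X" "c \<in> X" "2 * card X \<le> card {e\<in>F. e \<subseteq> X} + 3"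
    and Y: "Y \<subseteq> W" "c \<in> Y" "d \<in> Y" "2 * card Y \<le> card {e\<in>F. e \<subseteq> Y} + 3"
    and Z: "Z \<subseteq> W" "b \<in> Z" "d \<in> Z" "2 * card Z \<le> card {e\<in>F. e \<subseteq> Z} + 3"
    and dist: "b \<noteq> c" "c \<noteq> d" "b \<noteq> d"
  shows False
proof -
  let ?i = "\<lambda>X. {e\<in>F. e \<subseteq> X}"
  have finX: "finite X" "finite Y" "finite Z" using X(1) Y(1) Z(1) fin finite_subset by blast+
  have XY: "card (X \<inter> Y) \<le> 1"
    using union_tight[OF sp fin X(1) Y(1) X(4) Y(4)] noU[of "X \<union> Y"] X Y by force
  have YZ: "card (Y \<inter> Z) \<le> 1"
    using union_tight[OF sp fin Y(1) Z(1) Y(4) Z(4)] noU[of "Y \<union> Z"] Y Z by force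
  have XZ: "card (X \<inter> Z) \<le> 1"
    using union_tight[OF sp fin X(1) Z(1) X(4) Z(4)] noU[of "X \<union> Z"] X Z by force
  have single: "P = {x}" if "card P \<le> 1" "x \<in> P" "finite P" for P :: "'a set" and x
    using that by (metis card_le_Suc0_iff_eq One_nat_def is_singletonI' is_singleton_def singletonD empty_iff)
  have eq: "X \<inter> Y = {c}" "Y \<inter> Z = {d}" "X \<inter> Z = {b}"
    using single[OF XY] single[OF YZ] single[OF XZ] X Y Z finX by auto
  have "card (X \<union> Y) + 1 = card X + card Y"
    using card_Un_Int[OF finX(1,2)] eq by simp
  moreover have "(X \<union> Y) \<inter> Z = {b, d}" using eq by auto
  then have "card (X \<union> Y \<union> Z) + 2 = card (X \<union> Y) + card Z"
    using card_Un_Int[of "X \<union> Y" Z] finX dist by simp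
  moreover have disj: "?i P \<inter> ?i Q = {}" if "P \<inter> Q = {x}" for P Q x
  proof (rule ccontr)
    assume "?i P \<inter> ?i Q \<noteq> {}"
    then obtain e where "e \<in> F" "e \<subseteq> P" "e \<subseteq> Q" by blast
    then have "e \<in> F" "e \<subseteq> {x}" using that by blast+
    then show False using F2[of e] card_mono[of "{x}" e] by auto
  qed
  have "card (?i X \<union> ?i Y \<union> ?i Z) = card (?i X) + card (?i Y) + card (?i Z)"
    using disj[OF eq(1)] disj[OF eq(2)] disj[OF eq(3)] fin
    by (subst card_Un_disjoint; (subst card_Un_disjoint)?) auto
  moreover have "card (?i X \<union> ?i Y \<union> ?i Z) \<le> card (?i (X \<union> Y \<union> Z))"
    using fin by (intro card_mono) auto
  moreover have "card (?i (X \<union> Y \<union> Z)) + 3 < 2 * card (X \<union> Y \<union> Z)"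
    using X Y Z by (intro noU) auto
  ultimately show False using X(4) Y(4) Z(4) by linarith
qed

lemma sparse_insert_or_tight:
  assumes sp: "sparse_on W F" and fin: "finite F"
    and bad: "\<And>X. X \<subseteq> W \<Longrightarrow> b \<in> X \<Longrightarrow> c \<in> X \<Longrightarrow> card {e\<in>F. e \<subseteq> X} + 3 < 2 * card X"
    and bc: "b \<noteq> c" "b \<in> W" "c \<in> W"
  shows "{b, c} \<notin> F" "sparse_on W (insert {b, c} F)"
proof -
  show "{b, c} \<notin> F"
  proof
    assume "{b, c} \<in> F"
    then have "card {{b, c}} \<le> card {e\<in>F. e \<subseteq> {b, c}}"
      using fin by (intro card_mono) auto
    moreover have "card {e\<in>F. e \<subseteq> {b, c}} + 3 < 2 * card {b, c}"
      by (rule bad) (use bc in auto)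
    moreover have "card {b, c} = 2" "card {{b, c}} = 1" using bc(1) by simp_all
    ultimately show False by linarith
  qed
  show "sparse_on W (insert {b, c} F)"
    unfolding sparse_on_def
  proof (intro allI impI)
    fix X assume X: "X \<subseteq> W" "2 \<le> card X"
    show "card {e\<in>insert {b, c} F. e \<subseteq> X} + 3 \<le> 2 * card X"
    proof (cases "b \<in> X \<and> c \<in> X")
      case True
      then have "{e\<in>insert {b, c} F. e \<subseteq> X} = insert {b, c} {e\<in>F. e \<subseteq> X}" by auto
      then have "card {e\<in>insert {b, c} F. e \<subseteq> X} \<le> Suc (card {e\<in>F. e \<subseteq> X})"
        by (simp add: card_insert_le_m1 card_insert_if fin)
      then show ?thesis using bad[of X] X True by simp
    next
      case False
      then have "{e\<in>insert {b, c} F. e \<subseteq> X} = {e\<in>F. e \<subseteq> X}" by auto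
      then show ?thesis using sparse_onD[OF sp X] by simp
    qed
  qed
qed

lemma sparse_on_remove_vertex:
  assumes sp: "sparse_on W F" and fin: "finite F"
  shows "sparse_on (W - {v}) {e\<in>F. v \<notin> e}"
  unfolding sparse_on_def
proof (intro allI impI)
  fix X assume X: "X \<subseteq> W - {v}" "2 \<le> card X"
  have "card {e\<in>{e\<in>F. v \<notin> e}. e \<subseteq> X} \<le> card {e\<in>F. e \<subseteq> X}"
    using fin by (intro card_mono) auto
  moreover have "X \<subseteq> W" using X by blast
  then have "card {e\<in>F. e \<subseteq> X} + 3 \<le> 2 * card X"
    using sparse_onD[OF sp] X(2) by blast
  ultimately show "card {e\<in>{e\<in>F. v \<notin> e}. e \<subseteq> X} + 3 \<le> 2 * card X" by linarith
qed

lemma reduce_degree_three: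
  assumes sp: "sparse_on W F" and fin: "finite W" "finite F"
    and F2: "\<And>e. e \<in> F \<Longrightarrow> e \<subseteq> W \<and> card e = 2" and v: "v \<in> W"
    and edges: "{e\<in>F. v \<in> e} = {{v, b}, {v, c}, {v, d}}"
    and dist: "b \<noteq> c" "c \<noteq> d" "b \<noteq> d" "b \<noteq> v" "c \<noteq> v" "d \<noteq> v"
  obtains x y z where "{x, y, z} = {b, c, d}" "x \<noteq> y" "y \<noteq> z" "x \<noteq> z"
    "{x, y} \<notin> {e\<in>F. v \<notin> e}" "sparse_on (W - {v}) (insert {x, y} {e\<in>F. v \<notin> e})"
proof -
  let ?F = "{e\<in>F. v \<notin> e}"
  have sp': "sparse_on (W - {v}) ?F"
    by (rule sparse_on_remove_vertex[OF sp fin(2)])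
  have mem: "{v, b} \<in> F" "{v, c} \<in> F" "{v, d} \<in> F" using edges by blast+
  have W: "b \<in> W - {v}" "c \<in> W - {v}" "d \<in> W - {v}" using F2[OF mem(1)] F2[OF mem(2)] F2[OF mem(3)] dist by auto
  have noU: "card {e\<in>?F. e \<subseteq> U} + 3 < 2 * card U" if U: "U \<subseteq> W - {v}" "b \<in> U" "c \<in> U" "d \<in> U" for U
  proof -
    have finU: "finite U" using U(1) fin finite_subset by blast
    have vU: "v \<notin> U" using U by auto
    have "card ({e\<in>?F. e \<subseteq> U} \<union> {{v, b}, {v, c}, {v, d}}) \<le> card {e\<in>F. e \<subseteq> insert v U}"
      using fin U mem by (intro card_mono) auto
    moreover have "card ({e\<in>?F. e \<subseteq> U} \<union> {{v, b}, {v, c}, {v, d}}) = card {e\<in>?F. e \<subseteq> U} + card {{v, b}, {v, c}, {v, d}}"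
      using fin by (intro card_Un_disjoint) auto
    moreover have "card {{v, b}, {v, c}, {v, d}} = 3"
      using dist by (auto simp: doubleton_eq_iff)
    moreover have "card (insert v U) = Suc (card U)" using finU vU by simp
    moreover have "2 \<le> card (insert v U)"
    proof -
      have "card {v, b} \<le> card (insert v U)" using U finU by (intro card_mono) auto
      then show ?thesis using dist by simp
    qed
    moreover have "insert v U \<subseteq> W" using U v by auto
    ultimately show ?thesis using sparse_onD[OF sp, of "insert v U"] by simp
  qed
  define ok where "ok x y \<longleftrightarrow> (\<forall>X\<subseteq>W - {v}. x \<in> X \<longrightarrow> y \<in> X \<longrightarrow> card {e\<in>?F. e \<subseteq> X} + 3 < 2 * card X)" for x y
  have ins: "{x, y} \<notin> ?F \<and> sparse_on (W - {v}) (insert {x, y} ?F)"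
    if "ok x y" "x \<noteq> y" "x \<in> W - {v}" "y \<in> W - {v}" for x y
    using sparse_insert_or_tight[OF sp', of x y] that fin unfolding ok_def by simp
  have "ok b c \<or> ok c d \<or> ok b d"
  proof (rule ccontr)
    assume n: "\<not> (ok b c \<or> ok c d \<or> ok b d)"
    from n obtain X where X: "X \<subseteq> W - {v}" "b \<in> X" "c \<in> X" "2 * card X \<le> card {e\<in>?F. e \<subseteq> X} + 3"
      unfolding ok_def by (meson not_less)
    from n obtain Y where Y: "Y \<subseteq> W - {v}" "c \<in> Y" "d \<in> Y" "2 * card Y \<le> card {e\<in>?F. e \<subseteq> Y} + 3"
      unfolding ok_def by (meson not_less)
    from n obtain Z where Z: "Z \<subseteq> W - {v}" "b \<in> Z" "d \<in> Z" "2 * card Z \<le> card {e\<in>?F. e \<subseteq> Z} + 3"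
      unfolding ok_def by (meson not_less)
    show False
      by (rule no_three_tight_sets[OF sp' _ _ _ noU X Y Z dist(1-3)]) (use fin F2 in auto)
  qed
  then show ?thesis
  proof (elim disjE)
    assume "ok b c" then show ?thesis using that[of b c d] ins[of b c] W dist by blast
  next
    assume "ok c d" then show ?thesis using that[of c d b] ins[of c d] W dist by blast
  next
    assume "ok b d" then show ?thesis using that[of b d c] ins[of b d] W dist by blast
  qed
qed

section \<open>Independent placements in a plane\<close>

lemma edge_row_inner_cong:
  "(\<And>i. i \<in> e \<Longrightarrow> q $ i = q' $ i) \<Longrightarrow> edge_row q e \<bullet> z = edge_row q' e \<bullet> z"
  by (simp add: inner_edge_row)

lemma edge_row_inner_axis: "v \<notin> e \<Longrightarrow> edge_row q e \<bullet> axis v x = 0"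
  by (simp add: inner_axis edge_row_def)

lemma tangentially_independentD:
  assumes "tangentially_independent \<nu> F q" "e \<in> F"
    "\<And>z. (\<And>i. \<nu> (q $ i) \<bullet> z $ i = 0) \<Longrightarrow> (\<Sum>e\<in>F. l e * (edge_row q e \<bullet> z)) = 0"
  shows "l e = 0"
  using assms unfolding tangentially_independent_def by blast

text \<open>Moving \<open>b\<close> and \<open>c\<close> along two independent directions makes the oriented area of the triangle \<open>b c d\<close> a
  quadratic polynomial of the time with nonzero leading coefficient. So the triangle becomes
  nondegenerate at arbitrarily small times, at which independence persists.\<close>

lemma perturb_to_triangle:
  fixes y :: "(real^3)^'v::finite"
  assumes a: "a \<noteq> 0" and ti: "tangentially_independent (\<lambda>_. a) F y"
    and dist: "b \<noteq> c" "c \<noteq> d" "b \<noteq> d"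
  obtains y' where "tangentially_independent (\<lambda>_. a) F y'"
    "(y' $ b - y' $ d) \<bullet> ((y' $ c - y' $ d) \<times> a) \<noteq> 0"
proof -
  obtain x where x: "x \<noteq> 0" "orthogonal a x"
    using orthogonal_to_vector_exists[of a] by (auto simp: orthogonal_commute)
  define w where "w = axis b x + axis c (a \<times> x)"
  define P where "P t = y + t *\<^sub>R w" for t :: real
  have w: "w $ b = x" "w $ c = a \<times> x" "w $ d = 0"
    using dist by (auto simp: w_def axis_def)
  have eq: "tangentially_independent (\<lambda>_. a) F q \<longleftrightarrow>
      indep_family (F <+> UNIV) (\<lambda>c. normal_row (\<lambda>_. a) c q)" for q :: "(real^3)^'v"
    using indep_family_iff_tangential[of "\<lambda>_. a" q F] a by simp
  have "\<forall>\<^sub>F q in nhds y. indep_family (F <+> UNIV) (\<lambda>c. normal_row (\<lambda>_. a) c q)"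
  proof (rule eventually_indep_family)
    show "indep_family (F <+> UNIV) (\<lambda>c. normal_row (\<lambda>_. a) c y)" using ti eq by simp
    fix k :: "'v set + 'v"
    show "(normal_row (\<lambda>_. a) k \<longlongrightarrow> normal_row (\<lambda>_. a) k y) (nhds y)"
    proof (cases k)
      case (Inl e)
      have "normal_row (\<lambda>_. a) k = (\<lambda>q. edge_row q e)" using Inl by auto
      then show ?thesis
        using continuous_edge_row[of e]
        by (simp add: continuous_on_eq_continuous_at isCont_def tendsto_nhds_iff)
    next
      case (Inr i)
      then have "normal_row (\<lambda>_. a) k = (\<lambda>q. axis i a)" by auto
      then show ?thesis by simp
    qed
  qed
  moreover have "(P \<longlongrightarrow> P 0) (at 0)"
    unfolding P_def by (intro tendsto_intros)
  ultimately have "\<forall>\<^sub>F t in at 0. tangentially_independent (\<lambda>_. a) F (P t)"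
    unfolding eq by (intro eventually_compose_filterlim[of _ "nhds y" P]) (simp_all add: P_def)
  then obtain \<delta> where \<delta>: "\<delta> > 0" "\<And>t. t \<noteq> 0 \<Longrightarrow> dist t 0 < \<delta> \<Longrightarrow> tangentially_independent (\<lambda>_. a) F (P t)"
    unfolding eventually_at by auto
  define B C where "B = y $ b - y $ d" and "C = y $ c - y $ d"
  define p where "p = [:B \<bullet> (C \<times> a), B \<bullet> ((a \<times> x) \<times> a) + x \<bullet> (C \<times> a), x \<bullet> ((a \<times> x) \<times> a):]"
  have p: "(P t $ b - P t $ d) \<bullet> ((P t $ c - P t $ d) \<times> a) = poly p t" for t
  proof -
    have "P t $ b - P t $ d = B + t *\<^sub>R x" "P t $ c - P t $ d = C + t *\<^sub>R (a \<times> x)"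
      by (simp_all add: P_def w B_def C_def)
    then show ?thesis
      by (simp add: p_def cross_add_left cross_mult_left inner_add_left inner_add_right algebra_simps)
  qed
  have "x \<bullet> ((a \<times> x) \<times> a) = (a \<times> x) \<bullet> (a \<times> x)"
    using cross_triple[of "a \<times> x" a x] by (simp add: inner_commute)
  moreover have "a \<times> x \<noteq> 0"
    using norm_and_cross_eq_0[of a x] x a by (auto simp: orthogonal_def)
  ultimately have "p \<noteq> 0" by (simp add: p_def)
  then have "finite {t. poly p t = 0}" by (rule poly_roots_finite)
  then have "\<not> {0<..<\<delta>} \<subseteq> {t. poly p t = 0}"
    using infinite_Ioo[OF \<delta>(1)] finite_subset by blast
  then obtain t where "t \<in> {0<..<\<delta>}" "poly p t \<noteq> 0" by blast
  then show ?thesis using that[of "P t"] \<delta>(2)[of t] p[of t] by simp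
qed

text \<open>Once the new vertex is not collinear with its two neighbours, its own two components of a dependence
  force the coefficients of the new edges to vanish.\<close>

lemma extend_by_two_edges:
  fixes y :: "(real^3)^'v::finite"
  assumes a: "a \<noteq> 0" and ti: "tangentially_independent (\<lambda>_. a) F y"
    and v: "\<And>e. e \<in> F \<Longrightarrow> v \<notin> e" and dist: "b \<noteq> c" "c \<noteq> v" "b \<noteq> v"
  shows "\<exists>y'. tangentially_independent (\<lambda>_. a) (insert {v, b} (insert {v, c} F)) (y' :: (real^3)^'v)"
proof -
  obtain q where q: "tangentially_independent (\<lambda>_. a) F q"
    and det: "(q $ b - q $ v) \<bullet> ((q $ c - q $ v) \<times> a) \<noteq> 0"
    using perturb_to_triangle[OF a ti, of b c v] dist by metis
  let ?E = "insert {v, b} (insert {v, c} F)"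
  let ?B = "q $ b - q $ v" and ?C = "q $ c - q $ v"
  have det': "?C \<bullet> (?B \<times> a) \<noteq> 0"
  proof -
    have "?C \<bullet> (?B \<times> a) = - (?B \<bullet> (?C \<times> a))" by (simp add: cross3_simps)
    then show ?thesis using det by simp
  qed
  have nF: "{v, b} \<notin> F" "{v, c} \<notin> F" "{v, b} \<noteq> {v, c}"
    using v dist by (auto simp: doubleton_eq_iff)
  have "tangentially_independent (\<lambda>_. a) ?E q"
    unfolding tangentially_independent_def
  proof (intro allI impI)
    fix l assume l: "\<forall>z. (\<forall>i. a \<bullet> z $ i = 0) \<longrightarrow> (\<Sum>e\<in>?E. l e * (edge_row q e \<bullet> z)) = 0"
    have sum: "(\<Sum>e\<in>?E. l e * (edge_row q e \<bullet> z)) = l {v, b} * (edge_row q {v, b} \<bullet> z)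
        + l {v, c} * (edge_row q {v, c} \<bullet> z) + (\<Sum>e\<in>F. l e * (edge_row q e \<bullet> z))" for z
      using nF by simp
    have at_v: "l {v, b} * (?B \<bullet> x) + l {v, c} * (?C \<bullet> x) = 0" if x: "a \<bullet> x = 0" for x
    proof -
      have "(\<Sum>e\<in>F. l e * (edge_row q e \<bullet> axis v x)) = 0"
        using v by (intro sum.neutral) (simp add: edge_row_inner_axis)
      moreover have "edge_row q {v, b} \<bullet> axis v x = - (?B \<bullet> x)" "edge_row q {v, c} \<bullet> axis v x = - (?C \<bullet> x)"
        using dist by (simp_all add: inner_edge_row_doubleton axis_def inner_diff_left)
      moreover have "(\<Sum>e\<in>?E. l e * (edge_row q e \<bullet> axis v x)) = 0"
        using l x by (auto simp: axis_def)
      ultimately show ?thesis unfolding sum by simp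
    qed
    have "l {v, b} = 0"
      using at_v[of "?C \<times> a"] det by (simp add: dot_cross_self)
    moreover have "l {v, c} = 0"
      using at_v[of "?B \<times> a"] det' by (simp add: dot_cross_self)
    moreover have "l e = 0" if "e \<in> F" for e
      by (rule tangentially_independentD[OF q that]) (use l sum calculation in auto)
    ultimately show "\<forall>e\<in>?E. l e = 0" by auto
  qed
  then show ?thesis by blast
qed

text \<open>The new vertex is placed at the midpoint of the removed edge. The rows of its edges to \<open>b\<close>
  and \<open>c\<close> then have opposite components at the new vertex, and their sum is half the row of the
  edge between \<open>b\<close> and \<open>c\<close>.\<close>

lemma extend_by_splitting_edge:
  fixes y :: "(real^3)^'v::finite"
  assumes a: "a \<noteq> 0" and ti: "tangentially_independent (\<lambda>_. a) (insert {b, c} F) y"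
    and v: "\<And>e. e \<in> F \<Longrightarrow> v \<notin> e" and bc: "{b, c} \<notin> F"
    and dist: "b \<noteq> c" "c \<noteq> d" "b \<noteq> d" "b \<noteq> v" "c \<noteq> v" "d \<noteq> v"
  shows "\<exists>y'. tangentially_independent (\<lambda>_. a)
    (insert {v, b} (insert {v, c} (insert {v, d} F))) (y' :: (real^3)^'v)"
proof -
  obtain y1 where y1: "tangentially_independent (\<lambda>_. a) (insert {b, c} F) y1"
    and det1: "(y1 $ b - y1 $ d) \<bullet> ((y1 $ c - y1 $ d) \<times> a) \<noteq> 0"
    using perturb_to_triangle[OF a ti, of b c d] dist by metis
  define q where "q = (\<chi> i. if i = v then (1/2) *\<^sub>R (y1 $ b + y1 $ c) else y1 $ i)"
  define B C where "B = q $ b - q $ d" and "C = q $ c - q $ d"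
  have det: "B \<bullet> (C \<times> a) \<noteq> 0" using det1 dist by (simp add: B_def C_def q_def)
  have vb: "q $ v - q $ b = (1/2) *\<^sub>R (C - B)" and vc: "q $ v - q $ c = - ((1/2) *\<^sub>R (C - B))"
    and vd: "q $ v - q $ d = (1/2) *\<^sub>R (B + C)" and cb: "q $ b - q $ c = B - C"
    using dist by (simp_all add: B_def C_def q_def vec_eq_iff field_simps)
  let ?E = "insert {v, b} (insert {v, c} (insert {v, d} F))"
  have nF: "{v, b} \<notin> F" "{v, c} \<notin> F" "{v, d} \<notin> F" "{v, b} \<noteq> {v, c}" "{v, b} \<noteq> {v, d}" "{v, c} \<noteq> {v, d}"
    using v dist by (auto simp: doubleton_eq_iff)
  have "tangentially_independent (\<lambda>_. a) ?E q"
    unfolding tangentially_independent_def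
  proof (intro allI impI)
    fix l assume l: "\<forall>z. (\<forall>i. a \<bullet> z $ i = 0) \<longrightarrow> (\<Sum>e\<in>?E. l e * (edge_row q e \<bullet> z)) = 0"
    have sum: "(\<Sum>e\<in>?E. l e * (edge_row q e \<bullet> z)) = l {v, b} * (edge_row q {v, b} \<bullet> z)
        + l {v, c} * (edge_row q {v, c} \<bullet> z) + l {v, d} * (edge_row q {v, d} \<bullet> z)
        + (\<Sum>e\<in>F. l e * (edge_row q e \<bullet> z))" for z
      using nF by simp
    have at_v: "(l {v, b} - l {v, c}) * ((C - B) \<bullet> x) + l {v, d} * ((B + C) \<bullet> x) = 0"
      if x: "a \<bullet> x = 0" for x
    proof -
      have "(\<Sum>e\<in>F. l e * (edge_row q e \<bullet> axis v x)) = 0"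
        using v by (intro sum.neutral) (simp add: edge_row_inner_axis)
      moreover have row: "edge_row q {v, b} \<bullet> axis v x = (C - B) \<bullet> x / 2"
        "edge_row q {v, c} \<bullet> axis v x = - ((C - B) \<bullet> x / 2)"
        "edge_row q {v, d} \<bullet> axis v x = (B + C) \<bullet> x / 2"
        using dist unfolding inner_edge_row_doubleton vb vc vd by (simp_all add: axis_def)
      moreover have "(\<Sum>e\<in>?E. l e * (edge_row q e \<bullet> axis v x)) = 0"
        using l x by (auto simp: axis_def)
      ultimately have "l {v, b} * ((C - B) \<bullet> x / 2) + l {v, c} * - ((C - B) \<bullet> x / 2)
          + l {v, d} * ((B + C) \<bullet> x / 2) + 0 = 0"
        unfolding sum row by simp
      then show ?thesis by (simp add: algebra_simps add_divide_distrib diff_divide_distrib)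
    qed
    have "(B + C) \<bullet> ((C - B) \<times> a) = 2 * (B \<bullet> (C \<times> a))"
      by (simp add: cross3_simps)
    then have ld: "l {v, d} = 0"
      using at_v[of "(C - B) \<times> a"] det by (simp add: dot_cross_self)
    have "(C - B) \<bullet> (C \<times> a) = - (B \<bullet> (C \<times> a))"
      by (simp add: inner_diff_left dot_cross_self)
    then have lbc: "l {v, b} = l {v, c}"
      using at_v[of "C \<times> a"] det ld by (simp add: dot_cross_self)
    \<comment> \<open>The two new edges together act as half of the edge between \<open>b\<close> and \<open>c\<close>.\<close>
    define k where "k e = (if e = {b, c} then l {v, b} / 2 else l e)" for e
    have k0: "k e = 0" if "e \<in> insert {b, c} F" for e
    proof (rule tangentially_independentD[OF y1 that])
      fix z :: "(real^3)^'v" assume z: "\<And>i. a \<bullet> z $ i = 0"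
      have row: "edge_row q {v, b} \<bullet> z + edge_row q {v, c} \<bullet> z = edge_row q {b, c} \<bullet> z / 2"
        unfolding inner_edge_row_doubleton vb vc cb
        by (simp add: inner_diff_left inner_diff_right algebra_simps add_divide_distrib diff_divide_distrib)
      have "(\<Sum>e\<in>?E. l e * (edge_row q e \<bullet> z)) = 0"
        using l z by blast
      then have "l {v, b} * (edge_row q {v, b} \<bullet> z + edge_row q {v, c} \<bullet> z)
          + (\<Sum>e\<in>F. l e * (edge_row q e \<bullet> z)) = 0"
        unfolding sum using ld lbc by (simp add: distrib_left)
      then have "l {v, b} * (edge_row q {b, c} \<bullet> z / 2) + (\<Sum>e\<in>F. l e * (edge_row q e \<bullet> z)) = 0"
        unfolding row .
      moreover have "edge_row y1 {b, c} \<bullet> z = edge_row q {b, c} \<bullet> z"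
        using dist by (intro edge_row_inner_cong) (auto simp: q_def)
      moreover have "(\<Sum>e\<in>F. k e * (edge_row y1 e \<bullet> z)) = (\<Sum>e\<in>F. l e * (edge_row q e \<bullet> z))"
      proof (intro sum.cong refl)
        fix e assume e: "e \<in> F"
        have "edge_row y1 e \<bullet> z = edge_row q e \<bullet> z"
          using v[OF e] by (intro edge_row_inner_cong) (auto simp: q_def)
        then show "k e * (edge_row y1 e \<bullet> z) = l e * (edge_row q e \<bullet> z)"
          using e bc by (auto simp: k_def)
      qed
      ultimately show "(\<Sum>e\<in>insert {b, c} F. k e * (edge_row y1 e \<bullet> z)) = 0"
        using bc by (simp add: k_def)
    qed
    have "l e = 0" if "e \<in> F" for e using k0[of e] that bc by (auto simp: k_def split: if_splits)
    moreover have "l {v, b} = 0" using k0[of "{b, c}"] by (simp add: k_def)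
    ultimately show "\<forall>e\<in>?E. l e = 0" using ld lbc by auto
  qed
  then show ?thesis by blast
qed

text \<open>Henneberg induction. The degrees add up to less than four times the number of vertices, so some
  vertex has at most three neighbours; it has at least two, as the remaining vertices carry
  a sparse set of edges. A vertex of degree two is put back in general position, a vertex of degree three
  onto the edge that replaced it.\<close>

lemma plane_placement_exists:
  fixes F :: "'v::finite set set"
  assumes a: "a \<noteq> 0" and W: "2 \<le> card W" and F: "\<And>e. e \<in> F \<Longrightarrow> e \<subseteq> W \<and> card e = 2"
    and sp: "sparse_on W F" and tight: "card F + 3 = 2 * card W"
  shows "\<exists>y :: (real^3)^'v. tangentially_independent (\<lambda>_. a) F y"
  using W F sp tight
proof (induction "card W" arbitrary: W F rule: less_induct)
  case less
  have fin: "finite W" "finite F" by auto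
  show ?case
  proof (cases "card W = 2")
    case True
    then have "card F = 1" using less.prems(4) by simp
    then obtain e where e: "F = {e}" by (auto simp: card_1_singleton_iff)
    then obtain i j where ij: "e = {i, j}" "i \<noteq> j" using less.prems(2)[of e] by (auto simp: card_2_iff)
    obtain x where x: "x \<noteq> 0" "orthogonal a x"
      using orthogonal_to_vector_exists[of a] by (auto simp: orthogonal_commute)
    have "tangentially_independent (\<lambda>_. a) F (axis i x)"
      unfolding tangentially_independent_def e
    proof (intro allI impI ballI)
      fix l e' assume l: "\<forall>z. (\<forall>i. a \<bullet> z $ i = 0) \<longrightarrow> (\<Sum>e\<in>{e}. l e * (edge_row (axis i x) e \<bullet> z)) = 0"
        and e': "e' \<in> {e}"
      have "\<forall>k. a \<bullet> axis i x $ k = 0" using x by (simp add: axis_def orthogonal_def)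
      with l have "l e * (edge_row (axis i x) e \<bullet> axis i x) = 0" by simp
      then show "l e' = 0" using x e' ij by (simp add: inner_edge_row_doubleton axis_def)
    qed
    then show ?thesis by blast
  next
    case False
    with less.prems(1) have W3: "3 \<le> card W" by simp
    have "\<exists>v\<in>W. card {e\<in>F. v \<in> e} \<le> 3"
    proof (rule ccontr)
      assume "\<not> ?thesis"
      then have "4 \<le> card {e\<in>F. v \<in> e}" if "v \<in> W" for v using that by force
      then have "(\<Sum>v\<in>W. 4) \<le> (\<Sum>v\<in>W. card {e\<in>F. v \<in> e})" by (rule sum_mono)
      then show False using sum_degrees[OF fin less.prems(2)] less.prems(4) by simp
    qed
    then obtain v where v: "v \<in> W" and deg3: "card {e\<in>F. v \<in> e} \<le> 3" by blast
    let ?F = "{e\<in>F. v \<notin> e}" and ?W = "W - {v}"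
    have cW: "card ?W + 1 = card W" using v fin W3 by simp
    have "card ({e\<in>F. v \<in> e} \<union> ?F) = card {e\<in>F. v \<in> e} + card ?F"
      by (rule card_Un_disjoint) auto
    moreover have "{e\<in>F. v \<in> e} \<union> ?F = F" by auto
    ultimately have cF: "card F = card {e\<in>F. v \<in> e} + card ?F" by simp
    have sp': "sparse_on ?W ?F"
      by (rule sparse_on_remove_vertex[OF less.prems(3) fin(2)])
    have F': "e \<subseteq> ?W \<and> card e = 2" if "e \<in> ?F" for e
      using less.prems(2)[of e] that by auto
    have "{e\<in>?F. e \<subseteq> ?W} = ?F" using F' by auto
    then have "card ?F + 3 \<le> 2 * card ?W"
      using sparse_onD[OF sp', of ?W] cW W3 by simp
    then have deg2: "2 \<le> card {e\<in>F. v \<in> e}"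
      using cF cW less.prems(4) by linarith
    define N where "N = {x. {v, x} \<in> F}"
    have vN: "v \<notin> N" using less.prems(2)[of "{v, v}"] by (auto simp: N_def)
    have star: "{e\<in>F. v \<in> e} = (\<lambda>x. {v, x}) ` N"
    proof (intro equalityI subsetI)
      fix e assume "e \<in> {e\<in>F. v \<in> e}"
      then have e: "e \<in> F" "v \<in> e" "card e = 2" using less.prems(2) by auto
      then obtain x where "e = {v, x}" by (auto simp: card_2_iff)
      with e show "e \<in> (\<lambda>x. {v, x}) ` N" by (auto simp: N_def)
    qed (auto simp: N_def)
    have cN: "card {e\<in>F. v \<in> e} = card N"
      unfolding star by (rule card_image) (auto simp: inj_on_def doubleton_eq_iff)
    consider "card N = 2" | "card N = 3" using cN deg2 deg3 by linarith
    then show ?thesis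
    proof cases
      case 1
      then obtain b c where bc: "N = {b, c}" "b \<noteq> c" by (auto simp: card_2_iff)
      have "\<exists>y :: (real^3)^'v. tangentially_independent (\<lambda>_. a) ?F y"
        by (rule less.hyps[OF _ _ F' sp']) (use cW W3 cF cN 1 less.prems(4) in auto)
      then obtain y :: "(real^3)^'v" where "tangentially_independent (\<lambda>_. a) ?F y" ..
      from extend_by_two_edges[OF a this, of v b c]
      have "\<exists>y :: (real^3)^'v. tangentially_independent (\<lambda>_. a) (insert {v, b} (insert {v, c} ?F)) y"
        using bc vN by auto
      moreover have "{e\<in>F. v \<in> e} = {{v, b}, {v, c}}"
        unfolding star bc by simp
      then have "insert {v, b} (insert {v, c} ?F) = F" by blast
      ultimately show ?thesis by simp
    next
      case 2
      then obtain b c d where bcd: "N = {b, c, d}" "b \<noteq> c" "c \<noteq> d" "b \<noteq> d" by (auto simp: card_3_iff)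
      obtain x y z where xyz: "{x, y, z} = {b, c, d}" "x \<noteq> y" "y \<noteq> z" "x \<noteq> z"
        "{x, y} \<notin> ?F" "sparse_on ?W (insert {x, y} ?F)"
        by (rule reduce_degree_three[OF less.prems(3) fin less.prems(2) v, of b c d])
          (use star bcd vN in auto)
      have N': "N = {x, y, z}" using xyz(1) bcd(1) by simp
      have "{v, x} \<in> F" "{v, y} \<in> F" using N' by (auto simp: N_def)
      then have xy: "x \<in> ?W" "y \<in> ?W" using less.prems(2) vN N' by blast+
      have "\<exists>q :: (real^3)^'v. tangentially_independent (\<lambda>_. a) (insert {x, y} ?F) q"
      proof (rule less.hyps[OF _ _ _ xyz(6)])
        show "card ?W < card W" "2 \<le> card ?W" using cW W3 by simp_all
        show "e \<subseteq> ?W \<and> card e = 2" if "e \<in> insert {x, y} ?F" for e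
          using that F' xy xyz(2) by auto
        show "card (insert {x, y} ?F) + 3 = 2 * card ?W"
          using xyz(5) cW cF cN 2 less.prems(4) by simp
      qed
      then obtain q :: "(real^3)^'v" where "tangentially_independent (\<lambda>_. a) (insert {x, y} ?F) q" ..
      moreover have "x \<noteq> v" "y \<noteq> v" "z \<noteq> v" using vN N' by auto
      ultimately have "\<exists>q :: (real^3)^'v. tangentially_independent (\<lambda>_. a)
          (insert {v, x} (insert {v, y} (insert {v, z} ?F))) q"
        using xyz(2-5) by (intro extend_by_splitting_edge[OF a]) auto
      moreover have "{e\<in>F. v \<in> e} = {{v, x}, {v, y}, {v, z}}"
        unfolding star N' by simp
      then have "insert {v, x} (insert {v, y} (insert {v, z} ?F)) = F" by blast
      ultimately show ?thesis by simp
    qed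
  qed
qed

section \<open>Placements on planes and spheres\<close>

text \<open>Central projection. The placement is shifted along \<open>a\<close> into the plane \<open>a \<bullet> x = 1\<close>, with points
  \<open>x i\<close>, and then scaled radially, each point by its own factor \<open>s i\<close> to the sphere of its own radius.
  A tangential velocity \<open>z\<close> of the plane is corrected by multiples of \<open>a\<close> so as to be orthogonal to the
  rays, and scaled by the same factors. This multiplies the row of an edge between \<open>i\<close> and \<open>j\<close> by
  \<open>s i * s j\<close>, so dependences on the spheres become dependences in the plane.\<close>

lemma planar_independence_on_spheres:
  fixes y :: "(real^3)^'v::finite"
  assumes ti: "tangentially_independent (\<lambda>_. a) F y" and a: "a \<bullet> a = 1"
    and F: "\<And>e. e \<in> F \<Longrightarrow> card e = 2" and r: "\<And>i. 0 < r i"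
  shows "\<exists>p. (\<forall>i. p $ i \<in> sphere c (r i)) \<and> tangentially_independent (\<lambda>x. x - c) F p"
proof -
  define x where "x i = y $ i + (1 - a \<bullet> y $ i) *\<^sub>R a" for i
  define s where "s i = r i / norm (x i)" for i
  define p where "p = (\<chi> i. c + s i *\<^sub>R x i)"
  have ax: "a \<bullet> x i = 1" for i by (simp add: x_def inner_add_right a)
  have x0: "x i \<noteq> 0" for i using ax[of i] by auto
  have s0: "s i > 0" for i using r x0 by (simp add: s_def)
  have "p $ i \<in> sphere c (r i)" for i
    using r[of i] x0[of i] by (simp add: p_def s_def dist_norm)
  moreover have "tangentially_independent (\<lambda>x. x - c) F p"
    unfolding tangentially_independent_def
  proof (intro allI impI ballI)
    fix l e assume l: "\<forall>u. (\<forall>i. (p $ i - c) \<bullet> u $ i = 0) \<longrightarrow> (\<Sum>e\<in>F. l e * (edge_row p e \<bullet> u)) = 0"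
      and e: "e \<in> F"
    have "l e * (\<Prod>i\<in>e. s i) = 0"
    proof (rule tangentially_independentD[OF ti e])
      fix z :: "(real^3)^'v" assume z: "\<And>i. a \<bullet> z $ i = 0"
      define w where "w i = z $ i - (x i \<bullet> z $ i) *\<^sub>R a" for i
      define u where "u = (\<chi> i. s i *\<^sub>R w i)"
      have xw: "x i \<bullet> w j = x i \<bullet> z $ j - x j \<bullet> z $ j" for i j
        using ax[of i] by (simp add: w_def inner_diff_right inner_commute)
      have "\<forall>i. (p $ i - c) \<bullet> u $ i = 0"
        by (simp add: p_def u_def xw)
      with l have "(\<Sum>e\<in>F. l e * (edge_row p e \<bullet> u)) = 0" by blast
      moreover have "edge_row p e \<bullet> u = (\<Prod>i\<in>e. s i) * (edge_row y e \<bullet> z)" if eF: "e \<in> F" for e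
      proof -
        obtain i j where ij: "e = {i, j}" "i \<noteq> j" using F[OF eF] by (auto simp: card_2_iff)
        have "edge_row p e \<bullet> u = (s i *\<^sub>R x i - s j *\<^sub>R x j) \<bullet> (s i *\<^sub>R w i - s j *\<^sub>R w j)"
          unfolding ij inner_edge_row_doubleton by (simp add: p_def u_def)
        also have "\<dots> = - (s i * s j) * (x i \<bullet> w j + x j \<bullet> w i)"
          using xw[of i i] xw[of j j] by (simp add: inner_diff_left inner_diff_right algebra_simps)
        also have "x i \<bullet> w j + x j \<bullet> w i = - ((x i - x j) \<bullet> (z $ i - z $ j))"
          by (simp add: xw inner_diff_left inner_diff_right)
        also have "(x i - x j) \<bullet> (z $ i - z $ j) = (y $ i - y $ j) \<bullet> (z $ i - z $ j)"
          using z by (simp add: x_def inner_diff_left inner_diff_right inner_add_left)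
        finally show ?thesis
          using ij by (simp add: inner_edge_row_doubleton)
      qed
      ultimately show "(\<Sum>e\<in>F. l e * (\<Prod>i\<in>e. s i) * (edge_row y e \<bullet> z)) = 0"
        by (simp add: mult.assoc)
    qed
    moreover have "(\<Prod>i\<in>e. s i) > 0" using s0 by (intro prod_pos) simp
    ultimately show "l e = 0" by (metis less_irrefl mult_eq_0_iff)
  qed
  ultimately show ?thesis by blast
qed

lemma planar_independence_on_planes:
  fixes y :: "(real^3)^'v::finite"
  assumes ti: "tangentially_independent (\<lambda>_. a) F y" and a: "a \<noteq> 0"
    and F: "\<And>e. e \<in> F \<Longrightarrow> card e = 2"
  shows "\<exists>p. (\<forall>i. a \<bullet> p $ i = b i) \<and> tangentially_independent (\<lambda>_. a) F p"
proof -
  define p where "p = (\<chi> i. y $ i + ((b i - a \<bullet> y $ i) / (a \<bullet> a)) *\<^sub>R a)"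
  have "a \<bullet> p $ i = b i" for i using a by (simp add: p_def inner_add_right)
  moreover have "tangentially_independent (\<lambda>_. a) F p"
    unfolding tangentially_independent_def
  proof (intro allI impI ballI)
    fix l e assume l: "\<forall>z. (\<forall>i. a \<bullet> z $ i = 0) \<longrightarrow> (\<Sum>e\<in>F. l e * (edge_row p e \<bullet> z)) = 0"
      and e: "e \<in> F"
    show "l e = 0"
    proof (rule tangentially_independentD[OF ti e])
      fix z :: "(real^3)^'v" assume z: "\<And>i. a \<bullet> z $ i = 0"
      have "edge_row p e \<bullet> z = edge_row y e \<bullet> z" if eF: "e \<in> F" for e
      proof -
        obtain i j where ij: "e = {i, j}" using F[OF eF] by (auto simp: card_2_iff)
        show ?thesis
          using z by (simp add: ij inner_edge_row_doubleton p_def inner_diff_left inner_diff_right inner_add_left)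
      qed
      then have "(\<Sum>e\<in>F. l e * (edge_row y e \<bullet> z)) = (\<Sum>e\<in>F. l e * (edge_row p e \<bullet> z))"
        by (intro sum.cong) auto
      then show "(\<Sum>e\<in>F. l e * (edge_row y e \<bullet> z)) = 0" using l z by simp
    qed
  qed
  ultimately show ?thesis by blast
qed

text \<open>Besides the description by levels, this provides the transfer of planar independence to
  placements with each vertex on its prescribed surface; the two families of surfaces are treated alike
  from here on.\<close>

lemma surfaces_as_levels:
  fixes \<pi> :: "'v::finite \<Rightarrow> nat" and F :: "'v set set"
  assumes surf: "parallel_planes N S \<or> concentric_spheres N S"
    and pi: "\<And>v. \<pi> v \<in> {1..N}" and F: "\<And>e. e \<in> F \<Longrightarrow> card e = 2"
  obtains \<epsilon> d T a where "surface_family \<epsilon> d T" "a \<noteq> 0"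
    "(\<Union>k\<in>{1..N}. S k) = surface_family.surface \<epsilon> d T"
    "\<And>y. tangentially_independent (\<lambda>_. a) F y \<Longrightarrow> \<exists>p. (\<forall>v. p $ v \<in> S (\<pi> v)) \<and>
      tangentially_independent (surface_family.normal \<epsilon> d) F p"
  using surf
proof
  assume "parallel_planes N S"
  then obtain a where a: "a \<noteq> 0" "\<forall>k\<in>{1..N}. \<exists>b. S k = {x. a \<bullet> x = b}"
    by (auto simp: parallel_planes_def)
  then obtain b where b: "\<And>k. k \<in> {1..N} \<Longrightarrow> S k = {x. a \<bullet> x = b k}" by metis
  interpret surface_family 0 a "b ` {1..N}"
    by unfold_locales (use a in auto)
  show ?thesis
  proof (rule that)
    show "surface_family 0 a (b ` {1..N})" by unfold_locales
    show "(\<Union>k\<in>{1..N}. S k) = surface" unfolding surface_def potential_def using b by auto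
    fix y assume "tangentially_independent (\<lambda>_. a) F y"
    from planar_independence_on_planes[OF this a(1) F, of "\<lambda>v. b (\<pi> v)"]
    show "\<exists>p. (\<forall>v. p $ v \<in> S (\<pi> v)) \<and> tangentially_independent normal F p"
      using b pi by (simp add: normal_def[abs_def])
  qed (fact a)
next
  assume "concentric_spheres N S"
  then obtain c where "\<forall>k\<in>{1..N}. \<exists>r>0. S k = sphere c r"
    by (auto simp: concentric_spheres_def)
  then obtain r where r: "\<And>k. k \<in> {1..N} \<Longrightarrow> 0 < r k \<and> S k = sphere c (r k)" by metis
  define T where "T = (\<lambda>k. ((r k)\<^sup>2 - c \<bullet> c) / 2) ` {1..N}"
  have pot: "(1 / 2) * (x \<bullet> x) + (- c) \<bullet> x = ((dist c x)\<^sup>2 - c \<bullet> c) / 2" for x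
    by (simp add: dist_norm power2_norm_eq_inner inner_diff_left inner_diff_right inner_commute field_simps)
  interpret surface_family 1 "- c" T
  proof unfold_locales
    fix x assume "(1 / 2) * (x \<bullet> x) + (- c) \<bullet> x \<in> T"
    then obtain k where k: "k \<in> {1..N}" "(dist c x)\<^sup>2 = (r k)\<^sup>2"
      unfolding pot by (auto simp: T_def)
    with r[OF k(1)] have "x \<noteq> c" by auto
    then show "1 *\<^sub>R x + - c \<noteq> 0" by simp
  qed (auto simp: T_def)
  define a :: "real^3" where "a = axis 1 1"
  have aa: "a \<bullet> a = 1" by (simp add: a_def inner_axis')
  show ?thesis
  proof (rule that)
    show "surface_family 1 (- c) T" by unfold_locales
    show "a \<noteq> 0" using aa by auto
    have "x \<in> S k \<longleftrightarrow> potential x = ((r k)\<^sup>2 - c \<bullet> c) / 2" if "k \<in> {1..N}" for x k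
      using r[OF that] unfolding potential_def pot by (auto simp: power2_eq_iff_nonneg)
    then show "(\<Union>k\<in>{1..N}. S k) = surface"
      unfolding surface_def by (auto simp: T_def)
    fix y assume "tangentially_independent (\<lambda>_. a) F y"
    from planar_independence_on_spheres[OF this aa F, of "\<lambda>v. r (\<pi> v)" c]
    show "\<exists>p. (\<forall>v. p $ v \<in> S (\<pi> v)) \<and> tangentially_independent normal F p"
      using r pi by (simp add: normal_def[abs_def])
  qed
qed

lemma sparse_of_laman:
  fixes E :: "'v::finite set set"
  assumes "laman_graph UNIV E"
  shows "sparse_on UNIV E"
  unfolding sparse_on_def
proof (intro allI impI)
  fix X :: "'v set" assume X: "2 \<le> card X"
  show "card {e\<in>E. e \<subseteq> X} + 3 \<le> 2 * card X"
  proof (cases "{e\<in>E. e \<subseteq> X} = {}")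
    case True
    show ?thesis unfolding True using X by simp
  next
    case False
    have "subgraph X {e\<in>E. e \<subseteq> X} UNIV E"
      using assms by (auto simp: subgraph_def laman_graph_def simple_graph_def)
    with False assms have "3 \<le> freedom X {e\<in>E. e \<subseteq> X}"
      unfolding laman_graph_def by blast
    then show ?thesis by (simp add: freedom_def)
  qed
qed

theorem theorem5p1:
  fixes N :: nat and S :: "nat \<Rightarrow> (real^3) set" and M :: "(real^3) set"
    and E :: "'v::finite set set" and \<pi> :: "'v \<Rightarrow> nat"
    and h :: "(real^3)^'v \<Rightarrow> 'v \<Rightarrow> real^3 \<Rightarrow> real"
  assumes surfaces: "parallel_planes N S \<or> concentric_spheres N S"
    and M: "M = (\<Union>k\<in>{1..N}. S k)"
    and h: "local_equations M h"
    and graph: "simple_graph (UNIV :: 'v set) E"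
    and conn: "connected_graph (UNIV :: 'v set) E"
    and n: "CARD('v) \<ge> 2"
    and pi: "\<And>v. \<pi> v \<in> {1..N}"
  shows "(\<exists>p :: (real^3)^'v. (\<forall>v. p $ v \<in> S (\<pi> v)) \<and>
            minimally_rigid M E p \<and> completely_regular (h p) E p)
         \<longleftrightarrow> laman_graph (UNIV :: 'v set) E"
proof -
  have E2: "card e = 2" if "e \<in> E" for e
    using graph that by (auto simp: simple_graph_def)
  obtain \<epsilon> d T a where family: "surface_family \<epsilon> d T" and a: "a \<noteq> 0"
    and MU: "(\<Union>k\<in>{1..N}. S k) = surface_family.surface \<epsilon> d T"
    and place: "\<And>y. tangentially_independent (\<lambda>_. a) E y \<Longrightarrow> \<exists>p. (\<forall>v. p $ v \<in> S (\<pi> v)) \<and>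
      tangentially_independent (surface_family.normal \<epsilon> d) E p"
    by (rule surfaces_as_levels[of N S \<pi> E]) (use surfaces pi E2 in blast)+
  interpret surface_family \<epsilon> d T by (fact family)
  have MS: "M = surface" using M MU by simp
  have surf: "p $ i \<in> surface" if "\<forall>v. p $ v \<in> S (\<pi> v)" for p :: "(real^3)^'v" and i
    using that pi M MS by blast
  have loc: "local_equation surface (p $ i) (h p i)" if "\<forall>v. p $ v \<in> S (\<pi> v)" for p i
    using h surf[OF that] unfolding local_equations_def MS by blast
  have "\<not> (\<forall>u w :: 'v. u = w)"
    using n card_mono[of "{undefined}" "UNIV :: 'v set"] by fastforce
  then obtain u w :: 'v where "u \<noteq> w" by blast
  moreover have "(u, w) \<in> {(i, j). {i, j} \<in> E}\<^sup>*"
    using conn by (simp add: connected_graph_def)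
  ultimately obtain x where ux: "{u, x} \<in> E"
    by (auto elim: converse_rtranclE)
  show ?thesis
  proof
    assume "\<exists>p :: (real^3)^'v. (\<forall>v. p $ v \<in> S (\<pi> v)) \<and> minimally_rigid M E p \<and> completely_regular (h p) E p"
    then obtain p :: "(real^3)^'v" where p: "\<forall>v. p $ v \<in> S (\<pi> v)" and mr: "minimally_rigid M E p"
      and cr: "completely_regular (h p) E p" by blast
    note ps = surf[OF p] and lp = loc[OF p]
    have "subgraph {u, x} {{u, x}} UNIV E"
      using E2[OF ux] ux by (simp add: subgraph_def simple_graph_def)
    then have "regular (h p) {u, x} {{u, x}} p"
      using cr unfolding completely_regular_def by blast
    then have nd: "nondegenerate (p $ u) (p $ x)"
      by (rule nondegenerate_of_regular[OF _ _ ps lp]) (use E2[OF ux] in auto)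
    have "subgraph UNIV E UNIV E" using graph by (simp add: subgraph_def)
    then have reg: "regular (h p) UNIV E p"
      using cr unfolding completely_regular_def by blast
    have rig: "rigid surface E p" and min: "\<And>e. e \<in> E \<Longrightarrow> \<not> rigid surface (E - {e}) p"
      using mr unfolding minimally_rigid_def MS by blast+
    obtain F where FE: "F \<subseteq> E" and ind: "indep_family (F <+> UNIV) (\<lambda>c. gradient c p)"
      and F0: "F \<noteq> {}" and tight: "card F + 3 = 2 * CARD('v)"
      by (rule tight_basis_of_rigid[OF rig reg ux nd E2 ps lp]) blast+
    have rF: "rigid surface F p"
      by (rule rigid_of_indep_tight[OF ind _ F0 tight ps]) (use FE E2 in blast)
    \<comment> \<open>Any edge outside the rigid subgraph \<open>F\<close> could be removed, against minimality.\<close>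
    have "F = E"
    proof (rule ccontr)
      assume "F \<noteq> E"
      then obtain e where e: "e \<in> E" "e \<notin> F" using FE by blast
      then have "placements surface (E - {e}) p \<subseteq> placements surface F p"
        using FE by (auto simp: placements_def)
      then have "rigid surface (E - {e}) p"
        using rF unfolding rigid_def by blast
      with min[OF e(1)] show False by blast
    qed
    show "laman_graph UNIV E"
      unfolding laman_graph_def
    proof (intro conjI allI impI)
      show "simple_graph UNIV E" by (fact graph)
      show "freedom UNIV E = 3" using tight \<open>F = E\<close> by (simp add: freedom_def)
      fix W :: "'v set" and G assume G: "subgraph W G UNIV E \<and> G \<noteq> {}"
      have "indep_family (G <+> W) (\<lambda>c. gradient c p)"
        by (rule indep_family_mono[OF ind]) (use G \<open>F = E\<close> in \<open>auto simp: subgraph_def\<close>)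
      then have "card G + 3 \<le> 2 * card W"
        by (rule indep_gradients_count) (use G normal_nonzero ps in \<open>auto simp: subgraph_def simple_graph_def\<close>)
      then show "3 \<le> freedom W G" by (simp add: freedom_def)
    qed
  next
    assume laman: "laman_graph UNIV E"
    then have tight: "card E + 3 = 2 * CARD('v)"
      by (simp add: laman_graph_def freedom_def)
    have "\<exists>y :: (real^3)^'v. tangentially_independent (\<lambda>_. a) E y"
      by (rule plane_placement_exists[OF a n _ sparse_of_laman[OF laman] tight]) (use E2 in auto)
    then obtain p :: "(real^3)^'v" where p: "\<forall>v. p $ v \<in> S (\<pi> v)" and ti: "tangentially_independent normal E p"
      using place by blast
    note ps = surf[OF p] and lp = loc[OF p]
    have ind: "indep_family (E <+> UNIV) (\<lambda>c. gradient c p)"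
      using indep_family_iff_tangential[of normal p E] normal_nonzero[OF ps] ti by blast
    have "E \<noteq> {}" using ux by blast
    have "rigid surface E p"
      by (rule rigid_of_indep_tight[OF ind E2 \<open>E \<noteq> {}\<close> tight ps])
    moreover have "\<not> rigid surface (E - {e}) p" if "e \<in> E" for e
      by (rule not_rigid_remove_edge[OF ind that E2 ps])
    moreover have "regular (h p) W F p" if "subgraph W F UNIV E" for W F
    proof (rule regular_of_indep[OF _ ps lp])
      show "indep_family (F <+> W) (\<lambda>c. gradient c p)"
        by (rule indep_family_mono[OF ind]) (use that in \<open>auto simp: subgraph_def\<close>)
    qed (use that in \<open>auto simp: subgraph_def simple_graph_def\<close>)
    ultimately show "\<exists>p :: (real^3)^'v. (\<forall>v. p $ v \<in> S (\<pi> v)) \<and> minimally_rigid M E p \<and>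
        completely_regular (h p) E p"
      using p unfolding minimally_rigid_def completely_regular_def MS by blast
  qed
qed

end
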